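(* Let $T$ be the symmetric tridiagonal operator determined by sequences $a_n>0$, $b_n\in\mathbb{R}$ ($n\ge 1$), and let $m\in\mathbb{N}$, $m\ge 1$. Suppose that $\lim_{n\to\infty}|b_n|=\infty$ and $$\lim_{n\to\infty}a_nG_{m,n}^+=0,\qquad G_{m,n}^+=\sum_{(\boldsymbol{j}_m|\boldsymbol{k}_m)\in\mathcal{I}_m^+}\frac{a_{n-k_1}}{|b_{n-j_1}|}\,\frac{a_{n-k_2}}{|b_{n-j_2}|}\cdots\frac{a_{n-k_m}}{|b_{n-j_m}|}.$$ Then $T$ is self-adjoint and $\Lambda(T)=\sigma(T)$.
   Context: $(H,(\cdot,\cdot))$ is an infinite-dimensional complex Hilbert space with orthonormal basis $\{e_n\}_{n=1}^\infty$. Given real sequences $a_n>0$, $b_n\in\mathbb{R}$ ($n\ge1$), the formula $Te_n=a_ne_{n+1}+b_ne_n+a_{n-1}e_{n-1}$ (with $e_0=0$) defines a symmetric operator on the linear span of $\{e_n\}_{n=1}^\infty$; $T$ denotes the closure of this operator. $\sigma(T)$ is the spectrum of $T$. $T_N=P_NTP_N$ regarded as an operator on $H_N=\operatorname{span}\{e_1,\dots,e_N\}$, where $P_N$ is the orthogonal projection onto $H_N$. $\Lambda(T)$ is the set of all limit points of eigenvalues of $T_N$ as $N\to\infty$: $\lambda\in\Lambda(T)$ iff there is a sequence $\lambda_N\in\sigma(T_N)$ ($N\ge1$) having a subsequence converging to $\lambda$. Multi-indices: $\mathcal{I}_m^+$ is the set of pairs $(\boldsymbol{j}_m|\boldsymbol{k}_m)$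 with $\boldsymbol{j}_m=(j_1,\dots,j_m)\in\mathbb{Z}^m$, $\boldsymbol{k}_m=(k_1,\dots,k_m)\in\mathbb{Z}^m$ such that $j_1=0$; for each $s=1,\dots,m-1$ either $k_s=j_s=j_{s+1}+1$ or $k_s=j_s+1=j_{s+1}$; for $s=m$, $k_m=j_m$ or $k_m=j_m+1$; and all $j_s\ge0$ and all $k_s\ge1$. For example $\mathcal{I}_1^+=\{(0|1)\}$ and $\mathcal{I}_2^+=\{(0,1|1,1),(0,1|1,2)\}$. $G_{m,n}^+$ is considered for $n$ large enough that all indices are positive and all denominators nonzero. *)

theory Defs
  imports "HOL-Analysis.Analysis"
begin

section \<open>Complex Hilbert spaces\<close>

text \<open>
  The inner product is linear in its first and conjugate-linear in its second argument.
  Completeness comes from the class \<open>banach\<close>; the last axiom ties the norm (hence the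
  topology) to the inner product and contains positive definiteness.
\<close>

class chilbert_space = banach +
  fixes scaleC :: "complex \<Rightarrow> 'a \<Rightarrow> 'a" (infixr "*\<^sub>C" 75)
    and cinner :: "'a \<Rightarrow> 'a \<Rightarrow> complex"
  assumes scaleC_add_right: "c *\<^sub>C (x + y) = c *\<^sub>C x + c *\<^sub>C y"
    and scaleC_add_left: "(c + d) *\<^sub>C x = c *\<^sub>C x + d *\<^sub>C x"
    and scaleC_scaleC: "c *\<^sub>C (d *\<^sub>C x) = (c * d) *\<^sub>C x"
    and scaleR_scaleC: "r *\<^sub>R x = complex_of_real r *\<^sub>C x"
    and cinner_commute: "cinner x y = cnj (cinner y x)"
    and cinner_add_left: "cinner (x + y) z = cinner x z + cinner y z"
    and cinner_scaleC_left: "cinner (c *\<^sub>C x) y = c * cinner x y"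
    and cinner_self: "cinner x x = complex_of_real ((norm x)\<^sup>2)"

global_interpretation complex_vector: vector_space "scaleC :: complex \<Rightarrow> 'a::chilbert_space \<Rightarrow> 'a"
  defines cspan = complex_vector.span
proof
  fix x :: 'a
  show "1 *\<^sub>C x = x"
    using scaleR_scaleC[of 1 x] by simp
qed (auto simp: scaleC_add_right scaleC_add_left scaleC_scaleC)

text \<open>Bases are indexed by the positive integers; the value \<open>e 0\<close> is never used.\<close>

definition orthonormal_basis :: "(nat \<Rightarrow> 'a::chilbert_space) \<Rightarrow> bool" where
  "orthonormal_basis e \<longleftrightarrow>
     (\<forall>m\<ge>1. \<forall>n\<ge>1. cinner (e m) (e n) = (if m = n then 1 else 0)) \<and>
     closure (cspan (e ` {1..})) = UNIV"

definition orth_proj :: "'a::chilbert_space set \<Rightarrow> 'a \<Rightarrow> 'a" where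
  "orth_proj M x = (THE y. y \<in> M \<and> (\<forall>z\<in>M. cinner (x - y) z = 0))"


section \<open>Unbounded operators\<close>

text \<open>
  A (partially defined) linear operator is represented by its graph, so that \<open>Domain A\<close> is
  its domain of definition and the closure of the operator is the topological closure of
  the graph in the product space.
\<close>

definition adjoint_op :: "('a::chilbert_space \<times> 'a) set \<Rightarrow> ('a \<times> 'a) set" where
  "adjoint_op A = {(y, z). \<forall>(x, w)\<in>A. cinner w y = cinner x z}"

text \<open>For densely defined \<open>A\<close> the relation \<open>adjoint_op A\<close> is single-valued,
  so a self-adjoint \<open>A\<close> is the graph of a function.\<close>

definition self_adjoint :: "('a::chilbert_space \<times> 'a) set \<Rightarrow> bool" where
  "self_adjoint A \<longleftrightarrow> closure (Domain A) = UNIV \<and> adjoint_op A = A"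

text \<open>
  Spectrum of an operator \<open>A\<close> acting in the closed subspace \<open>K\<close>, that is with
  domain and range in \<open>K\<close>: \<open>z\<close> is in the resolvent set iff \<open>A - z\<close> is
  a bijection from the domain of \<open>A\<close> onto \<open>K\<close> with bounded inverse.
\<close>

definition resolvent_set_on ::
  "'a::chilbert_space set \<Rightarrow> ('a \<times> 'a) set \<Rightarrow> complex set" where
  "resolvent_set_on K A =
     {z. (\<forall>u\<in>K. \<exists>!x. (x, u + z *\<^sub>C x) \<in> A) \<and>
         (\<exists>C. \<forall>(x, y)\<in>A. norm x \<le> C * norm (y - z *\<^sub>C x))}"

definition spectrum_on ::
  "'a::chilbert_space set \<Rightarrow> ('a \<times> 'a) set \<Rightarrow> complex set" where
  "spectrum_on K A = - resolvent_set_on K A"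

abbreviation spectrum :: "('a::chilbert_space \<times> 'a) set \<Rightarrow> complex set" where
  "spectrum A \<equiv> spectrum_on UNIV A"


section \<open>Tridiagonal operators and their truncations\<close>

text \<open>The vector $T e_n$ for $n \ge 1$, with the convention $e_0 = 0$.\<close>

definition tridiag_basis ::
  "(nat \<Rightarrow> real) \<Rightarrow> (nat \<Rightarrow> real) \<Rightarrow> (nat \<Rightarrow> 'a::chilbert_space) \<Rightarrow> nat \<Rightarrow> 'a" where
  "tridiag_basis a b e n =
     a n *\<^sub>R e (n + 1) + b n *\<^sub>R e n + (if n = 1 then 0 else a (n - 1) *\<^sub>R e (n - 1))"

definition tridiag_pre ::
  "(nat \<Rightarrow> real) \<Rightarrow> (nat \<Rightarrow> real) \<Rightarrow> (nat \<Rightarrow> 'a::chilbert_space) \<Rightarrow> ('a \<times> 'a) set" where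
  "tridiag_pre a b e =
     {(\<Sum>n=1..k. c n *\<^sub>C e n, \<Sum>n=1..k. c n *\<^sub>C tridiag_basis a b e n) | c k. True}"

definition tridiag_op ::
  "(nat \<Rightarrow> real) \<Rightarrow> (nat \<Rightarrow> real) \<Rightarrow> (nat \<Rightarrow> 'a::chilbert_space) \<Rightarrow> ('a \<times> 'a) set" where
  "tridiag_op a b e = closure (tridiag_pre a b e)"

definition trunc_space :: "(nat \<Rightarrow> 'a::chilbert_space) \<Rightarrow> nat \<Rightarrow> 'a set" where
  "trunc_space e N = cspan (e ` {1..N})"

text \<open>The operator $P_N T P_N$ restricted to $H_N$.\<close>

definition trunc_op ::
  "(nat \<Rightarrow> 'a::chilbert_space) \<Rightarrow> ('a \<times> 'a) set \<Rightarrow> nat \<Rightarrow> ('a \<times> 'a) set" where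
  "trunc_op e T N =
     (let P = orth_proj (trunc_space e N)
      in {(x, P y) | x y. x \<in> trunc_space e N \<and> (P x, y) \<in> T})"

definition limit_eigenvalues ::
  "(nat \<Rightarrow> 'a::chilbert_space) \<Rightarrow> ('a \<times> 'a) set \<Rightarrow> complex set" where
  "limit_eigenvalues e T =
     {z. \<exists>l r. (\<forall>N\<ge>1. l N \<in> spectrum_on (trunc_space e N) (trunc_op e T N)) \<and>
               strict_mono r \<and> (l \<circ> r) \<longlonglongrightarrow> z}"


section \<open>Multi-indices\<close>

text \<open>The entry $j_s$ is \<open>j ! (s - 1)\<close>, as lists are indexed from 0.\<close>

definition multi_indices :: "nat \<Rightarrow> (int list \<times> int list) set" where
  "multi_indices m =
     {(j, k). length j = m \<and> length k = m \<and>
        j ! 0 = 0 \<and>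
        (\<forall>s. s + 1 < m \<longrightarrow>
           (k ! s = j ! s \<and> j ! s = j ! (s + 1) + 1) \<or>
           (k ! s = j ! s + 1 \<and> j ! s + 1 = j ! (s + 1))) \<and>
        (k ! (m - 1) = j ! (m - 1) \<or> k ! (m - 1) = j ! (m - 1) + 1) \<and>
        (\<forall>s<m. j ! s \<ge> 0 \<and> k ! s \<ge> 1)}"

text \<open>
  For \<open>n > m\<close> all indices are positive, so the truncation by \<open>nat\<close> has no effect then.
  Under $|b_n| \to \infty$ the convention \<open>x / 0 = 0\<close> concerns only finitely many \<open>n\<close>.
\<close>

definition G_plus ::
  "(nat \<Rightarrow> real) \<Rightarrow> (nat \<Rightarrow> real) \<Rightarrow> nat \<Rightarrow> nat \<Rightarrow> real" where
  "G_plus a b m n =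
     (\<Sum>(j, k)\<in>multi_indices m.
        \<Prod>s<m. a (nat (int n - k ! s)) / \<bar>b (nat (int n - j ! s))\<bar>)"

lemma multi_indices_bounds:
  assumes "(j, k) \<in> multi_indices m" "s < m"
  shows "j ! s \<le> int s" "k ! s \<le> int s + 1"
proof -
  have step: "(k ! s = j ! s \<and> j ! s = j ! (s + 1) + 1) \<or>
      (k ! s = j ! s + 1 \<and> j ! s + 1 = j ! (s + 1))" if "s + 1 < m" for s
    using assms(1) that by (auto simp: multi_indices_def)
  have *: "j ! s \<le> int s" if "s < m" for s
    using that
  proof (induction s)
    case 0
    then show ?case using assms(1) by (auto simp: multi_indices_def)
  next
    case (Suc s)
    then show ?case using step[of s] by auto
  qed
  show "j ! s \<le> int s" using * assms(2) .
  show "k ! s \<le> int s + 1"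
  proof (cases "s + 1 < m")
    case True
    then show ?thesis using step[of s] *[of s] by auto
  next
    case False
    then have "s = m - 1" using assms(2) by simp
    then show ?thesis using assms(1) *[of s] assms(2) by (auto simp: multi_indices_def)
  qed
qed

lemma finite_multi_indices: "finite (multi_indices m)"
proof -
  let ?L = "{xs. set xs \<subseteq> {0..int m} \<and> length xs = m}"
  have "multi_indices m \<subseteq> ?L \<times> ?L"
  proof (rule subrelI)
    fix j k assume jk: "(j, k) \<in> multi_indices m"
    then have len: "length j = m" "length k = m"
      and pos: "\<And>s. s < m \<Longrightarrow> j ! s \<ge> 0 \<and> k ! s \<ge> 1"
      by (auto simp: multi_indices_def)
    have "j ! s \<in> {0..int m} \<and> k ! s \<in> {0..int m}" if "s < m" for s
      using pos[OF that] multi_indices_bounds[OF jk that] that by auto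
    then show "(j, k) \<in> ?L \<times> ?L"
      using len by (auto simp: in_set_conv_nth)
  qed
  moreover have "finite ?L"
    by (rule finite_lists_length_eq) simp
  ultimately show ?thesis
    by (meson finite_SigmaI finite_subset)
qed

lemma multi_indices_1: "multi_indices 1 = {([0], [1])}"
  by (auto simp: multi_indices_def length_Suc_conv)

lemma multi_indices_2: "multi_indices 2 = {([0, 1], [1, 1]), ([0, 1], [1, 2])}"
proof -
  have len2: "length xs = 2 \<longleftrightarrow> (\<exists>x y. xs = [x, y])" for xs :: "int list"
    by (auto simp: length_Suc_conv numeral_2_eq_2)
  have all2: "(\<forall>s<2. P s) \<longleftrightarrow> P 0 \<and> P 1" for P :: "nat \<Rightarrow> bool"
    by (auto simp: less_2_cases_iff)
  have all1: "(\<forall>s. s + 1 < 2 \<longrightarrow> P s) \<longleftrightarrow> P 0" for P :: "nat \<Rightarrow> bool"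
    by auto
  show ?thesis
    unfolding multi_indices_def len2 all2 all1 by auto
qed

end

theory Submission
  imports Defs
begin

text \<open>
  If \<open>T\<^sub>N x = z x\<close>, or merely \<open>(T\<^sub>N - z) x = f\<close> with \<open>f\<close> supported far from \<open>N\<close>, then
  \<open>(b\<^sub>i - z) x\<^sub>i = - a\<^sub>i x\<^sub>i\<^sub>+\<^sub>1 - a\<^sub>i\<^sub>-\<^sub>1 x\<^sub>i\<^sub>-\<^sub>1\<close> near \<open>N\<close>; iterating this \<open>m\<close> times from \<open>i = N\<close> gives
  \<open>\<bar>x\<^sub>N\<bar> \<le> 2\<^sup>m G\<^sup>+ \<parallel>x\<parallel>\<close>, because \<open>\<bar>b\<^sub>i - z\<bar> \<ge> \<bar>b\<^sub>i\<bar> / 2\<close> eventually. So the defect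
  \<open>(T - T\<^sub>N) x = a\<^sub>N x\<^sub>N e\<^sub>N\<^sub>+\<^sub>1\<close> tends to \<open>0\<close>. For nonreal \<open>z\<close> this makes the closed range of
  \<open>T - z\<close> dense, whence self-adjointness; for eigenvectors of \<open>T\<^sub>N\<close> it gives approximate
  eigenvectors of \<open>T\<close>, whence \<open>\<Lambda>(T) \<subseteq> \<sigma>(T)\<close>. Conversely a point of the spectrum has approximate
  eigenvectors of finite support, on which \<open>T\<close> and \<open>T\<^sub>N\<close> agree for large \<open>N\<close>, and a Hermitian matrix
  has an eigenvalue as close to \<open>\<lambda>\<close> as the residual of any unit vector.
\<close>

section \<open>The inner product\<close>

lemma cinner_add_right: "cinner x (y + z) = cinner x y + cinner x z"
  by (metis cinner_add_left cinner_commute complex_cnj_add)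

lemma cinner_scaleC_right: "cinner x (c *\<^sub>C y) = cnj c * cinner x y"
  by (metis cinner_commute cinner_scaleC_left complex_cnj_mult)

lemma cinner_zero_left [simp]: "cinner 0 x = 0"
  by (metis add_cancel_right_left add.left_neutral cinner_add_left)

lemma cinner_zero_right [simp]: "cinner x 0 = 0"
  by (metis cinner_commute cinner_zero_left complex_cnj_zero)

lemma cinner_minus_left: "cinner (- x) y = - cinner x y"
  by (metis add.right_inverse add_eq_0_iff cinner_add_left cinner_zero_left)

lemma cinner_minus_right: "cinner x (- y) = - cinner x y"
  by (metis cinner_commute cinner_minus_left complex_cnj_minus)

lemma cinner_diff_left: "cinner (x - y) z = cinner x z - cinner y z"
  using cinner_add_left[of x "- y" z] by (simp add: cinner_minus_left)

lemma cinner_diff_right: "cinner x (y - z) = cinner x y - cinner x z"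
  using cinner_add_right[of x y "- z"] by (simp add: cinner_minus_right)

lemma Re_cinner_commute: "Re (cinner x y) = Re (cinner y x)"
  by (subst cinner_commute) simp

lemma norm_sq_cinner: "(norm x)\<^sup>2 = Re (cinner x x)"
  by (simp add: cinner_self)

lemma cinner_self_eq_0 [simp]: "cinner x x = 0 \<longleftrightarrow> x = 0"
  by (simp add: cinner_self)

lemma norm_scaleC: "norm (c *\<^sub>C x) = cmod c * norm x"
proof -
  have "complex_of_real ((norm (c *\<^sub>C x))\<^sup>2) = c * (cnj c * cinner x x)"
    by (simp only: cinner_self[symmetric] cinner_scaleC_left cinner_scaleC_right mult.left_commute)
  also have "\<dots> = complex_of_real ((cmod c * norm x)\<^sup>2)"
    by (simp only: cinner_self mult.assoc[symmetric] complex_norm_square[symmetric]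
        of_real_mult[symmetric] power_mult_distrib)
  finally have "(norm (c *\<^sub>C x))\<^sup>2 = (cmod c * norm x)\<^sup>2"
    by (simp only: of_real_eq_iff)
  then show ?thesis
    by (simp add: power2_eq_iff_nonneg)
qed

lemma norm_add_sq: "(norm (x + y))\<^sup>2 = (norm x)\<^sup>2 + 2 * Re (cinner x y) + (norm y)\<^sup>2"
  using Re_cinner_commute[of y x]
  by (simp add: norm_sq_cinner cinner_add_left cinner_add_right)

lemma Cauchy_Schwarz_cinner: "cmod (cinner x y) \<le> norm x * norm y"
proof (cases "y = 0")
  case False
  define t where "t = - (cinner x y / complex_of_real ((norm y)\<^sup>2))"
  have ny: "(norm y)\<^sup>2 > 0" using False by simp
  have "Re (cinner x (t *\<^sub>C y)) = - ((cmod (cinner x y))\<^sup>2 / (norm y)\<^sup>2)"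
  proof -
    have "cinner x (t *\<^sub>C y) = - (cnj (cinner x y) * cinner x y / complex_of_real ((norm y)\<^sup>2))"
      by (simp add: cinner_scaleC_right cinner_minus_right t_def)
    also have "\<dots> = complex_of_real (- ((cmod (cinner x y))\<^sup>2 / (norm y)\<^sup>2))"
      by (simp add: mult.commute[of "cnj _"] complex_norm_square[symmetric] del: of_real_power)
    finally show ?thesis by (simp only: Re_complex_of_real)
  qed
  moreover have "(norm (t *\<^sub>C y))\<^sup>2 = (cmod (cinner x y))\<^sup>2 / (norm y)\<^sup>2"
  proof -
    have "cmod t = cmod (cinner x y) / (norm y)\<^sup>2"
      by (simp add: t_def norm_divide norm_power)
    then show ?thesis
      using False by (simp add: norm_scaleC power2_eq_square field_simps)
  qed
  ultimately have "0 \<le> (norm x)\<^sup>2 - (cmod (cinner x y))\<^sup>2 / (norm y)\<^sup>2"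
    using norm_add_sq[of x "t *\<^sub>C y"] zero_le_power2[of "norm (x + t *\<^sub>C y)"] by linarith
  then have "(cmod (cinner x y))\<^sup>2 \<le> (norm x * norm y)\<^sup>2"
    using ny by (simp add: field_simps power_mult_distrib)
  then show ?thesis
    by (rule power2_le_imp_le) simp
qed simp

lemma bounded_bilinear_cinner: "bounded_bilinear cinner"
proof
  show "\<exists>K. \<forall>x y. cmod (cinner x y) \<le> norm x * norm y * K"
    by (intro exI[of _ 1]) (simp add: Cauchy_Schwarz_cinner)
qed (simp_all add: cinner_add_left cinner_add_right scaleR_scaleC cinner_scaleC_left
      cinner_scaleC_right scaleR_conv_of_real)

lemma bounded_bilinear_scaleC: "bounded_bilinear scaleC"
proof
  fix r :: real and c :: complex and x :: 'a
  show "c *\<^sub>C r *\<^sub>R x = r *\<^sub>R c *\<^sub>C x"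
    by (simp add: scaleR_scaleC scaleC_scaleC mult.commute)
  show "\<exists>K. \<forall>c (x::'a). norm (c *\<^sub>C x) \<le> norm c * norm x * K"
    by (intro exI[of _ 1]) (simp add: norm_scaleC)
qed (simp_all add: scaleC_add_left scaleC_add_right scaleR_scaleC scaleC_scaleC
      scaleR_conv_of_real)

lemmas cinner_sum_left = bounded_bilinear.sum_left[OF bounded_bilinear_cinner]
lemmas cinner_sum_right = bounded_bilinear.sum_right[OF bounded_bilinear_cinner]
lemmas continuous_on_cinner [continuous_intros] =
  bounded_bilinear.continuous_on[OF bounded_bilinear_cinner]
lemmas continuous_on_scaleC [continuous_intros] =
  bounded_bilinear.continuous_on[OF bounded_bilinear_scaleC]
lemmas tendsto_scaleC [tendsto_intros] = bounded_bilinear.tendsto[OF bounded_bilinear_scaleC]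


section \<open>Symmetric operators\<close>

lemma closed_adjoint_op: "closed (adjoint_op A)"
proof -
  have "adjoint_op A = (\<Inter>p\<in>A. {q. cinner (snd p) (fst q) = cinner (fst p) (snd q)})"
    by (fastforce simp: adjoint_op_def)
  moreover have "closed {q::'a\<times>'a. cinner w (fst q) = cinner x (snd q)}" for x w
    by (intro closed_Collect_eq continuous_intros)
  ultimately show ?thesis by auto
qed

lemma adjoint_op_swap: "A \<subseteq> adjoint_op B \<longleftrightarrow> B \<subseteq> adjoint_op A"
proof -
  have "B \<subseteq> adjoint_op A" if "A \<subseteq> adjoint_op B" for A B :: "('a \<times> 'a) set"
    using that unfolding adjoint_op_def
    by (smt (verit) case_prodD case_prodI2 cinner_commute mem_Collect_eq subset_iff case_prodI)
  then show ?thesis by blast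
qed

text \<open>Adjoints are closed, so \<open>closure A \<subseteq> adjoint_op A\<close>; exchanging
  the roles gives \<open>A \<subseteq> adjoint_op (closure A)\<close>, and closing once more
  finishes.\<close>

lemma closure_subset_adjoint_op:
  assumes "A \<subseteq> adjoint_op A"
  shows "closure A \<subseteq> adjoint_op (closure A)"
  using assms closed_adjoint_op adjoint_op_swap closure_minimal by metis

text \<open>The hypothesis makes \<open>cinner y x\<close> real, so the cross term with the
  imaginary part of the shift has zero real part. This yields both the bound for nonreal shifts and
  the contraction constant in \<open>real_resolventI\<close>.\<close>

lemma norm_diff_scaleC_sq_symmetric:
  assumes "cinner y x = cinner x y"
  shows "(norm (y - z *\<^sub>C x))\<^sup>2 =
    (norm (y - complex_of_real (Re z) *\<^sub>C x))\<^sup>2 + (Im z)\<^sup>2 * (norm x)\<^sup>2"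
proof -
  have "Im (cinner y x) = 0"
    using assms by (metis cinner_commute complex_cnj_cancel_iff complex_is_Real_iff Reals_cnj_iff)
  then show ?thesis
    using Re_cinner_commute[of x y]
    by (simp add: norm_sq_cinner cinner_diff_left cinner_diff_right cinner_scaleC_left
        cinner_scaleC_right)
       (simp add: assms[symmetric] cinner_self power2_eq_square algebra_simps)
qed

definition op_linear :: "('a::chilbert_space \<times> 'a) set \<Rightarrow> bool" where
  "op_linear A \<longleftrightarrow>
     (\<forall>x y x' y' c. (x, y) \<in> A \<longrightarrow> (x', y') \<in> A \<longrightarrow> (x + c *\<^sub>C x', y + c *\<^sub>C y') \<in> A)"

lemma op_linear_comb:
  "op_linear A \<Longrightarrow> (x, y) \<in> A \<Longrightarrow> (x', y') \<in> A \<Longrightarrow> (x + c *\<^sub>C x', y + c *\<^sub>C y') \<in> A"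
  by (auto simp: op_linear_def)

lemma op_linear_diff:
  "op_linear A \<Longrightarrow> (x, y) \<in> A \<Longrightarrow> (x', y') \<in> A \<Longrightarrow> (x - x', y - y') \<in> A"
  using op_linear_comb[of A x y x' y' "-1"]
  by (simp add: complex_vector.scale_minus_left)

lemma op_linear_closure:
  assumes "op_linear A"
  shows "op_linear (closure A)"
  unfolding op_linear_def
proof (intro allI impI)
  fix x y x' y' :: 'a and c
  assume "(x, y) \<in> closure A" "(x', y') \<in> closure A"
  then obtain f g where f: "\<And>n. f n \<in> A" "f \<longlonglongrightarrow> (x, y)"
    and g: "\<And>n. g n \<in> A" "g \<longlonglongrightarrow> (x', y')"
    unfolding closure_sequential by blast
  let ?h = "\<lambda>n. (fst (f n) + c *\<^sub>C fst (g n), snd (f n) + c *\<^sub>C snd (g n))"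
  have "?h n \<in> A" for n
    using op_linear_comb[OF assms] f(1)[of n] g(1)[of n] by (metis prod.collapse)
  moreover have "?h \<longlonglongrightarrow> (x + c *\<^sub>C x', y + c *\<^sub>C y')"
    using tendsto_fst[OF f(2)] tendsto_snd[OF f(2)] tendsto_fst[OF g(2)] tendsto_snd[OF g(2)]
    by (auto intro!: tendsto_intros)
  ultimately show "(x + c *\<^sub>C x', y + c *\<^sub>C y') \<in> closure A"
    unfolding closure_sequential by (intro exI[of _ ?h]) auto
qed

section \<open>Lower bounds, resolvent points and self-adjointness\<close>

lemma symmetric_lower_bound:
  assumes "A \<subseteq> adjoint_op A" "(x, y) \<in> A"
  shows "\<bar>Im z\<bar> * norm x \<le> norm (y - z *\<^sub>C x)"
proof -
  have "cinner y x = cinner x y" using assms by (auto simp: adjoint_op_def)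
  from norm_diff_scaleC_sq_symmetric[OF this, of z]
  have "(\<bar>Im z\<bar> * norm x)\<^sup>2 \<le> (norm (y - z *\<^sub>C x))\<^sup>2"
    by (simp add: power_mult_distrib)
  then show ?thesis by (rule power2_le_imp_le) simp
qed

text \<open>Applied to differences, the lower bound makes solutions unique, and its reciprocal
  bounds the inverse; only solvability has to be supplied.\<close>

lemma resolvent_set_onI:
  assumes lin: "op_linear A" and c: "c > 0"
    and bnd: "\<And>x y. (x, y) \<in> A \<Longrightarrow> c * norm x \<le> norm (y - z *\<^sub>C x)"
    and surj: "\<And>u. u \<in> K \<Longrightarrow> \<exists>x. (x, u + z *\<^sub>C x) \<in> A"
  shows "z \<in> resolvent_set_on K A"
proof -
  have uniq: "x = x'" if "(x, u + z *\<^sub>C x) \<in> A" "(x', u + z *\<^sub>C x') \<in> A" for x x' u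
    using bnd[OF op_linear_diff[OF lin that]] c
    by (auto simp: complex_vector.scale_right_diff_distrib mult_le_0_iff)
  have "norm x \<le> (1 / c) * norm (y - z *\<^sub>C x)" if "(x, y) \<in> A" for x y
    using bnd[OF that] c by (simp add: field_simps)
  then have "\<exists>C. \<forall>(x, y)\<in>A. norm x \<le> C * norm (y - z *\<^sub>C x)"
    by (intro exI[of _ "1 / c"]) auto
  moreover have "\<exists>!x. (x, u + z *\<^sub>C x) \<in> A" if "u \<in> K" for u
    using surj[OF that] uniq by metis
  ultimately show ?thesis
    unfolding resolvent_set_on_def by simp
qed

text \<open>If the right-hand sides converge, the lower bound makes the solutions Cauchy;
  completeness and the closed graph then give a solution for the limit.\<close>

lemma closed_range_of_lower_bound:
  assumes lin: "op_linear A" and clo: "closed A" and c: "c > 0"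
    and bnd: "\<And>x y. (x, y) \<in> A \<Longrightarrow> c * norm x \<le> norm (y - z *\<^sub>C x)"
  shows "closed {u. \<exists>x. (x, u + z *\<^sub>C x) \<in> A}"
  unfolding closed_sequential_limits
proof (intro allI impI, elim conjE)
  fix u l
  assume "\<forall>n. u n \<in> {u. \<exists>x. (x, u + z *\<^sub>C x) \<in> A}" and ul: "u \<longlonglongrightarrow> l"
  then obtain x where x: "\<And>n. (x n, u n + z *\<^sub>C x n) \<in> A"
    by simp metis
  have "c * norm (x m - x n) \<le> norm (u m - u n)" for m n
    using bnd[OF op_linear_diff[OF lin x[of m] x[of n]]]
    by (simp add: complex_vector.scale_right_diff_distrib)
  then have le: "dist (x m) (x n) \<le> dist (u m) (u n) / c" for m n
    using c by (simp add: dist_norm field_simps)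
  have "Cauchy x"
  proof (rule metric_CauchyI)
    fix r :: real assume "r > 0"
    then have "r * c > 0" using c by simp
    moreover have "Cauchy u" using ul by (rule LIMSEQ_imp_Cauchy)
    ultimately obtain M where "\<forall>m\<ge>M. \<forall>n\<ge>M. dist (u m) (u n) < r * c"
      unfolding Cauchy_def by blast
    then have "\<forall>m\<ge>M. \<forall>n\<ge>M. dist (x m) (x n) < r"
      using le c by (smt (verit) pos_divide_less_eq)
    then show "\<exists>M. \<forall>m\<ge>M. \<forall>n\<ge>M. dist (x m) (x n) < r" by blast
  qed
  then obtain x0 where x0: "x \<longlonglongrightarrow> x0"
    by (auto simp: Cauchy_convergent_iff convergent_def)
  have "(\<lambda>n. (x n, u n + z *\<^sub>C x n)) \<longlonglongrightarrow> (x0, l + z *\<^sub>C x0)"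
    using ul x0 by (auto intro!: tendsto_intros)
  then have "(x0, l + z *\<^sub>C x0) \<in> A"
    by (rule closed_sequentially[OF clo x])
  then show "l \<in> {u. \<exists>x. (x, u + z *\<^sub>C x) \<in> A}" by blast
qed

lemma self_adjointI:
  assumes sym: "A \<subseteq> adjoint_op A" and lin: "op_linear A" and dense: "closure (Domain A) = UNIV"
    and surj: "\<And>u. \<exists>x. (x, u + \<i> *\<^sub>C x) \<in> A" "\<And>u. \<exists>x. (x, u + (- \<i>) *\<^sub>C x) \<in> A"
  shows "self_adjoint A"
proof -
  have "(y, z) \<in> A" if yz: "(y, z) \<in> adjoint_op A" for y z
  proof -
    \<comment> \<open>Here \<open>(A - \<i>) x = z - \<i> y\<close> and
      \<open>(A + \<i>) v = y - x\<close>. The first puts \<open>y - x\<close> into the kernel of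
      the adjoint minus \<open>\<i>\<close>, so it is orthogonal to the range of
      \<open>A + \<i>\<close>; by the second it is orthogonal to itself.\<close>
    obtain x where x: "(x, (z - \<i> *\<^sub>C y) + \<i> *\<^sub>C x) \<in> A" using surj(1) by blast
    obtain v where v: "(v, (y - x) + (- \<i>) *\<^sub>C v) \<in> A" using surj(2) by blast
    have 1: "cinner ((y - x) + (- \<i>) *\<^sub>C v) y = cinner v z"
      using yz v by (auto simp: adjoint_op_def)
    have 2: "cinner ((y - x) + (- \<i>) *\<^sub>C v) x = cinner v ((z - \<i> *\<^sub>C y) + \<i> *\<^sub>C x)"
      using sym v x by (fastforce simp: adjoint_op_def)
    have "cinner (y - x) (y - x) = 0"
      using 1 2 by (simp add: cinner_add_left cinner_add_right cinner_diff_left cinner_diff_right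
          cinner_scaleC_left cinner_scaleC_right algebra_simps)
    then have "y = x" by simp
    then show ?thesis using x by simp
  qed
  then show ?thesis
    using sym dense unfolding self_adjoint_def by auto
qed

text \<open>For real \<open>\<lambda>\<close> the operator \<open>A - \<lambda> - \<i>\<close> is onto with inverse of norm at most
  \<open>1 / sqrt (c\<^sup>2 + 1) < 1\<close>, so \<open>(A - \<lambda>) x = u\<close> is a contractive fixed-point equation.\<close>

lemma real_resolventI:
  fixes A :: "('a::chilbert_space \<times> 'a) set" and l :: real
  assumes sym: "A \<subseteq> adjoint_op A" and lin: "op_linear A" and c: "c > 0"
    and bnd: "\<And>x y. (x, y) \<in> A \<Longrightarrow> c * norm x \<le> norm (y - complex_of_real l *\<^sub>C x)"
    and surj: "\<And>u. \<exists>x. (x, u + Complex l 1 *\<^sub>C x) \<in> A"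
  shows "complex_of_real l \<in> resolvent_set_on UNIV A"
proof (rule resolvent_set_onI[OF lin c bnd])
  fix u :: 'a
  obtain R where R: "\<And>u. (R u, u + Complex l 1 *\<^sub>C R u) \<in> A"
    using surj by metis
  define q where "q = 1 / sqrt (c\<^sup>2 + 1)"
  have cs: "sqrt (c\<^sup>2 + 1) > 1" using c by simp
  have q: "0 \<le> q" "q < 1"
    unfolding q_def by (simp, rule divide_less_eq_1_pos[THEN iffD2]) (use cs in linarith)+
  have R_diff: "norm (R v - R w) \<le> q * norm (v - w)" for v w
  proof -
    let ?x = "R v - R w" and ?y = "(v - w) + Complex l 1 *\<^sub>C (R v - R w)"
    have A: "(?x, ?y) \<in> A"
      using op_linear_diff[OF lin R[of v] R[of w]]
      by (simp only: complex_vector.scale_right_diff_distrib add_diff_add)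
    have "cinner ?y ?x = cinner ?x ?y" using sym A by (auto simp: adjoint_op_def)
    from norm_diff_scaleC_sq_symmetric[OF this, of "Complex l 1"]
    have "(norm (v - w))\<^sup>2 = (norm (?y - complex_of_real l *\<^sub>C ?x))\<^sup>2 + (norm ?x)\<^sup>2" by simp
    moreover have "(c * norm ?x)\<^sup>2 \<le> (norm (?y - complex_of_real l *\<^sub>C ?x))\<^sup>2"
      using bnd[OF A] c by (intro power_mono) auto
    ultimately have "(c\<^sup>2 + 1) * (norm ?x)\<^sup>2 \<le> (norm (v - w))\<^sup>2"
      by (simp add: power_mult_distrib algebra_simps)
    then have "sqrt ((c\<^sup>2 + 1) * (norm ?x)\<^sup>2) \<le> norm (v - w)"
      by (simp add: real_le_lsqrt)
    then have "sqrt (c\<^sup>2 + 1) * norm ?x \<le> norm (v - w)"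
      by (simp add: real_sqrt_mult)
    moreover have "sqrt (c\<^sup>2 + 1) > 0" using cs by linarith
    ultimately show ?thesis
      by (simp add: q_def pos_le_divide_eq mult.commute del: real_sqrt_gt_0_iff)
  qed
  \<comment> \<open>A fixed point satisfies \<open>(A - l - \<i>) x = u - \<i> x\<close>, where the
    terms \<open>\<i> x\<close> cancel.\<close>
  have "\<exists>!x. R (u - \<i> *\<^sub>C x) = x"
  proof (rule banach_fix_type[OF q], intro allI)
    fix x y :: 'a
    have "(u - \<i> *\<^sub>C x) - (u - \<i> *\<^sub>C y) = \<i> *\<^sub>C (y - x)"
      by (simp add: complex_vector.scale_right_diff_distrib)
    then show "dist (R (u - \<i> *\<^sub>C x)) (R (u - \<i> *\<^sub>C y)) \<le> q * dist x y"
      using R_diff[of "u - \<i> *\<^sub>C x" "u - \<i> *\<^sub>C y"]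
      by (simp add: dist_norm norm_scaleC norm_minus_commute)
  qed
  then obtain x where x: "R (u - \<i> *\<^sub>C x) = x" by blast
  have "Complex l 1 = complex_of_real l + \<i>" by (simp add: complex_eq_iff)
  then have "(u - \<i> *\<^sub>C x) + Complex l 1 *\<^sub>C x = u + complex_of_real l *\<^sub>C x"
    by (simp add: scaleC_add_left)
  then show "\<exists>x. (x, u + complex_of_real l *\<^sub>C x) \<in> A"
    using R[of "u - \<i> *\<^sub>C x"] unfolding x by (intro exI[of _ x]) (simp only:)
qed

text \<open>A minimizer \<open>u\<close> of \<open>\<parallel>B x\<parallel>\<close> on the unit sphere of \<open>K\<close> satisfies
  \<open>B\<^sup>2 u = \<mu>\<^sup>2 u\<close>, and \<open>B\<^sup>2 - \<mu>\<^sup>2 = (B - \<mu>) (B + \<mu>)\<close>.\<close>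

lemma eigenvector_of_minimizer:
  fixes B :: "'a::chilbert_space \<Rightarrow> 'a" and r :: real
  assumes K: "complex_vector.subspace K" and BK: "\<And>x. x \<in> K \<Longrightarrow> B x \<in> K"
    and lin: "\<And>x y c. B (x + c *\<^sub>C y) = B x + c *\<^sub>C B y"
    and sym: "\<And>x y. x \<in> K \<Longrightarrow> y \<in> K \<Longrightarrow> cinner (B x) y = cinner x (B y)"
    and u: "u \<in> K" "u \<noteq> 0" "norm (B u) = r * norm u"
    and min: "\<And>x. x \<in> K \<Longrightarrow> r * norm x \<le> norm (B x)" and r: "r \<ge> 0"
  shows "\<exists>w\<in>K. w \<noteq> 0 \<and> (B w = complex_of_real r *\<^sub>C w \<or> B w = complex_of_real (- r) *\<^sub>C w)"
proof -
  define h where "h = B (B u) - complex_of_real (r\<^sup>2) *\<^sub>C u"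
  have hK: "h \<in> K"
    unfolding h_def by (intro complex_vector.subspace_diff complex_vector.subspace_scale K BK u)
  have min2: "r\<^sup>2 * (norm x)\<^sup>2 \<le> (norm (B x))\<^sup>2" if "x \<in> K" for x
    using power_mono[OF min[OF that], of 2] r by (simp add: power_mult_distrib)
  \<comment> \<open>Perturb \<open>u\<close> in the direction \<open>h\<close>: by minimality the
    quadratic in \<open>t\<close> is nonnegative, it vanishes at \<open>t = 0\<close>, and its
    linear coefficient is twice the squared norm of \<open>h\<close>.\<close>
  have quad: "0 \<le> 2 * t * (norm h)\<^sup>2 + t\<^sup>2 * ((norm (B h))\<^sup>2 - r\<^sup>2 * (norm h)\<^sup>2)" for t :: real
  proof -
    let ?x = "u + complex_of_real t *\<^sub>C h"
    have "?x \<in> K"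
      by (intro complex_vector.subspace_add complex_vector.subspace_scale K hK u)
    from min2[OF this]
    have "0 \<le> (norm (B u + complex_of_real t *\<^sub>C B h))\<^sup>2 - r\<^sup>2 * (norm ?x)\<^sup>2"
      by (simp add: lin)
    also have "\<dots> = ((norm (B u))\<^sup>2 - r\<^sup>2 * (norm u)\<^sup>2)
        + 2 * t * Re (cinner (B u) (B h) - complex_of_real (r\<^sup>2) * cinner u h)
        + t\<^sup>2 * ((norm (B h))\<^sup>2 - r\<^sup>2 * (norm h)\<^sup>2)"
      by (simp add: norm_add_sq cinner_scaleC_right norm_scaleC power_mult_distrib
          algebra_simps)
    also have "(norm (B u))\<^sup>2 - r\<^sup>2 * (norm u)\<^sup>2 = 0"
      using u(3) by (simp add: power_mult_distrib)
    also have "cinner (B u) (B h) - complex_of_real (r\<^sup>2) * cinner u h = cinner h h"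
      using sym[OF BK[OF u(1)] hK]
      by (simp add: h_def cinner_diff_left cinner_scaleC_left)
    finally show ?thesis by (simp add: norm_sq_cinner)
  qed
  have "(norm h)\<^sup>2 = 0"
  proof (rule ccontr)
    define H where "H = (norm h)\<^sup>2"
    define Q where "Q = (norm (B h))\<^sup>2 - r\<^sup>2 * (norm h)\<^sup>2"
    assume "(norm h)\<^sup>2 \<noteq> 0"
    then have H: "H > 0" by (simp add: H_def)
    have Q: "Q \<ge> 0" using min2[OF hK] by (simp add: Q_def)
    \<comment> \<open>Modelled on the minimizer \<open>- H / Q\<close> of the quadratic;
      \<open>Q + 1\<close> keeps the denominator positive when \<open>Q = 0\<close>.\<close>
    define t where "t = - (H / (Q + 1))"
    have "2 * t * H + t\<^sup>2 * Q = - (H\<^sup>2 * (Q + 2) / (Q + 1)\<^sup>2)"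
    proof -
      have "Q + 1 \<noteq> 0" using Q by simp
      then show ?thesis
        unfolding t_def power2_eq_square by (simp add: divide_simps) (simp add: algebra_simps)
    qed
    moreover have "H\<^sup>2 * (Q + 2) / (Q + 1)\<^sup>2 > 0" using H Q by simp
    ultimately show False using quad[of t] by (simp add: H_def Q_def)
  qed
  then have BB: "B (B u) = complex_of_real (r\<^sup>2) *\<^sub>C u" by (simp add: h_def)
  \<comment> \<open>\<open>(B + r) u\<close> is annihilated by \<open>B - r\<close>; if it is zero,
    \<open>u\<close> itself is an eigenvector for \<open>- r\<close>.\<close>
  define w where "w = B u + complex_of_real r *\<^sub>C u"
  show ?thesis
  proof (cases "w = 0")
    case True
    then have "B u = complex_of_real (- r) *\<^sub>C u"
      by (simp add: w_def complex_vector.scale_minus_left eq_neg_iff_add_eq_0)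
    then show ?thesis using u by blast
  next
    case False
    have "w \<in> K"
      unfolding w_def by (intro complex_vector.subspace_add complex_vector.subspace_scale K BK u)
    moreover have "B w = complex_of_real r *\<^sub>C w"
      unfolding w_def lin BB
      by (simp add: scaleC_add_right scaleC_scaleC power2_eq_square add.commute)
    ultimately show ?thesis using False by blast
  qed
qed

lemma eigenvector_in_spectrum_on:
  assumes lin: "op_linear A" and "(w, z *\<^sub>C w) \<in> A" "w \<noteq> 0" "0 \<in> K"
  shows "z \<in> spectrum_on K A"
proof -
  have "(0, 0 + z *\<^sub>C 0) \<in> A" "(w, 0 + z *\<^sub>C w) \<in> A"
    using op_linear_diff[OF lin assms(2) assms(2)] assms(2) by auto
  then have "\<not> (\<exists>!x. (x, 0 + z *\<^sub>C x) \<in> A)" using assms(3) by blast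
  then show ?thesis using assms(4) unfolding spectrum_on_def resolvent_set_on_def by blast
qed

section \<open>Sums over multi-indices\<close>

text \<open>The multi-indices with \<open>j\<^sub>1 = j\<close>, built from the front. They record the paths starting at the
  vertex \<open>n - j\<close> and staying in \<open>{..n}\<close>.\<close>

fun paths :: "nat \<Rightarrow> int \<Rightarrow> (int list \<times> int list) set" where
  "paths 0 j = {([], [])}"
| "paths (Suc m) j = (\<lambda>(js, ks). (j # js, (j + 1) # ks)) ` paths m (j + 1) \<union>
     (if j \<ge> 1 then (\<lambda>(js, ks). (j # js, j # ks)) ` paths m (j - 1) else {})"

lemma finite_paths: "finite (paths m j)"
  by (induction m arbitrary: j) auto

text \<open>The guard \<open>s + 1 < m\<close> lets the last position share the disjunction of the
  others: there only the choice of \<open>ks ! s\<close> remains, as in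
  \<open>multi_indices\<close>.\<close>

lemma paths_nth:
  assumes "(js, ks) \<in> paths m j" "j \<ge> 0"
  shows "length js = m \<and> length ks = m \<and> (m > 0 \<longrightarrow> js ! 0 = j) \<and>
    (\<forall>s<m. js ! s \<ge> 0 \<and> ks ! s \<ge> 1 \<and>
      (ks ! s = js ! s \<and> (s + 1 < m \<longrightarrow> js ! s = js ! (s + 1) + 1) \<or>
       ks ! s = js ! s + 1 \<and> (s + 1 < m \<longrightarrow> js ! s + 1 = js ! (s + 1))))"
  using assms
proof (induction m arbitrary: j js ks)
  case (Suc m)
  obtain i k js' ks' where eq: "js = j # js'" "ks = k # ks'" and mem: "(js', ks') \<in> paths m i"
    and i: "i \<ge> 0" "k \<ge> 1" "k = j + 1 \<and> i = j + 1 \<or> k = j \<and> i = j - 1"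
    using Suc.prems by (fastforce split: if_splits)
  note IH = Suc.IH[OF mem i(1)]
  show ?case
    unfolding eq using IH i Suc.prems(2)
    by (auto simp: less_Suc_eq_0_disj)
qed simp

text \<open>For upper bounds this inclusion suffices, since all terms of \<open>G_plus\<close> are
  nonnegative for \<open>n > m\<close>.\<close>

lemma paths_subset_multi_indices:
  assumes "m \<ge> 1"
  shows "paths m 0 \<subseteq> multi_indices m"
proof (rule subrelI)
  fix js ks assume "(js, ks) \<in> paths m 0"
  note P = paths_nth[OF this order_refl]
  have "m - 1 < m" using assms by simp
  with P have "ks ! (m - 1) = js ! (m - 1) \<or> ks ! (m - 1) = js ! (m - 1) + 1" by blast
  moreover have "ks ! s = js ! s \<and> js ! s = js ! (s + 1) + 1 \<or>
      ks ! s = js ! s + 1 \<and> js ! s + 1 = js ! (s + 1)" if "s + 1 < m" for s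
  proof -
    have "s < m" using that by simp
    with P that show ?thesis by blast
  qed
  ultimately show "(js, ks) \<in> multi_indices m"
    unfolding multi_indices_def using P assms by simp
qed

section \<open>Weights of paths and their recursion\<close>

definition path_weight ::
  "(nat \<Rightarrow> real) \<Rightarrow> (nat \<Rightarrow> real) \<Rightarrow> nat \<Rightarrow> nat \<Rightarrow> int list \<times> int list \<Rightarrow> real" where
  "path_weight a b n m = (\<lambda>(js, ks).
     \<Prod>s<m. a (nat (int n - ks ! s)) / \<bar>b (nat (int n - js ! s))\<bar>)"

lemma path_weight_Cons:
  "path_weight a b n (Suc m) (j # js, k # ks) =
     a (nat (int n - k)) / \<bar>b (nat (int n - j))\<bar> * path_weight a b n m (js, ks)"
  by (simp add: path_weight_def prod.lessThan_Suc_shift del: prod.lessThan_Suc)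

text \<open>Splitting off the first step mirrors the three-term recurrence solved for the entry at
  \<open>n - j\<close>. The neighbour \<open>n - j + 1\<close> enters only for
  \<open>j \<ge> 1\<close>, so that no path goes beyond \<open>n\<close>.\<close>

lemma sum_paths_Suc:
  "sum (path_weight a b n (Suc m)) (paths (Suc m) j) =
    (a (nat (int n - (j + 1))) * sum (path_weight a b n m) (paths m (j + 1)) +
      (if j \<ge> 1 then a (nat (int n - j)) * sum (path_weight a b n m) (paths m (j - 1)) else 0))
    / \<bar>b (nat (int n - j))\<bar>"
proof -
  have *: "sum (path_weight a b n (Suc m)) ((\<lambda>(js, ks). (j # js, k # ks)) ` paths m i) =
      a (nat (int n - k)) / \<bar>b (nat (int n - j))\<bar> * sum (path_weight a b n m) (paths m i)" for i k
  proof -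
    have "inj_on (\<lambda>(js, ks). (j # js, k # ks)) (paths m i)"
      by (auto simp: inj_on_def)
    then show ?thesis
      by (simp add: sum.reindex sum_distrib_left path_weight_Cons case_prod_unfold o_def)
  qed
  \<comment> \<open>The two families are disjoint: their second lists begin with
    \<open>j + 1\<close> and with \<open>j\<close>.\<close>
  have "sum (path_weight a b n (Suc m)) (paths (Suc m) j) =
      sum (path_weight a b n (Suc m)) ((\<lambda>(js, ks). (j # js, (j + 1) # ks)) ` paths m (j + 1)) +
      sum (path_weight a b n (Suc m))
        (if j \<ge> 1 then (\<lambda>(js, ks). (j # js, j # ks)) ` paths m (j - 1) else {})"
    unfolding paths.simps by (rule sum.union_disjoint) (auto simp: finite_paths)
  then show ?thesis
    by (cases "j \<ge> 1") (simp_all add: * add_divide_distrib)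
qed

section \<open>Tridiagonal operators\<close>

locale tridiagonal =
  fixes e :: "nat \<Rightarrow> 'a::chilbert_space" and a b :: "nat \<Rightarrow> real"
  assumes basis: "orthonormal_basis e"
    and a_pos: "n \<ge> 1 \<Longrightarrow> a n > 0"
begin

definition lincomb :: "nat \<Rightarrow> (nat \<Rightarrow> complex) \<Rightarrow> 'a" where
  "lincomb N c = (\<Sum>n=1..N. c n *\<^sub>C e n)"

text \<open>Vanishing at \<open>0\<close> and beyond \<open>N\<close> is the boundary condition
  under which \<open>jacobi\<close> describes \<open>T\<close> on \<open>H_N\<close> without special
  cases at the ends.\<close>

definition cutoff :: "nat \<Rightarrow> (nat \<Rightarrow> complex) \<Rightarrow> nat \<Rightarrow> complex" where
  "cutoff N c n = (if 1 \<le> n \<and> n \<le> N then c n else 0)"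

text \<open>Meant for sequences with \<open>c 0 = 0\<close>, which annihilates the last term for \<open>n = 1\<close>.\<close>

definition jacobi :: "(nat \<Rightarrow> complex) \<Rightarrow> nat \<Rightarrow> complex" where
  "jacobi c n = complex_of_real (a n) * c (n + 1) + complex_of_real (b n) * c n
     + complex_of_real (a (n - 1)) * c (n - 1)"

lemma cutoff_0 [simp]: "cutoff N c 0 = 0"
  by (simp add: cutoff_def)

lemma cutoff_greater [simp]: "n > N \<Longrightarrow> cutoff N c n = 0"
  by (simp add: cutoff_def)

lemma cutoff_inside [simp]: "1 \<le> n \<Longrightarrow> n \<le> N \<Longrightarrow> cutoff N c n = c n"
  by (simp add: cutoff_def)

lemma cutoff_cong: "(\<And>n. 1 \<le> n \<Longrightarrow> n \<le> N \<Longrightarrow> c n = d n) \<Longrightarrow> cutoff N c = cutoff N d"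
  by (auto simp: cutoff_def)

lemma cutoff_comb: "cutoff N (\<lambda>n. c n + z * d n) = (\<lambda>n. cutoff N c n + z * cutoff N d n)"
  by (auto simp: cutoff_def)

lemma jacobi_comb: "jacobi (\<lambda>n. c n + z * d n) = (\<lambda>n. jacobi c n + z * jacobi d n)"
  by (auto simp: jacobi_def algebra_simps)

lemma jacobi_zero: "c n = 0 \<Longrightarrow> c (n + 1) = 0 \<Longrightarrow> c (n - 1) = 0 \<Longrightarrow> jacobi c n = 0"
  by (simp add: jacobi_def)

lemma jacobi_cutoff_last: "jacobi (cutoff N c) (Suc N) = complex_of_real (a N) * cutoff N c N"
  by (simp add: jacobi_def)

section \<open>Finite linear combinations of the basis and their density\<close>

lemma cinner_basis: "m \<ge> 1 \<Longrightarrow> n \<ge> 1 \<Longrightarrow> cinner (e m) (e n) = (if m = n then 1 else 0)"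
  using basis by (simp add: orthonormal_basis_def)

lemma lincomb_cong: "(\<And>n. 1 \<le> n \<Longrightarrow> n \<le> N \<Longrightarrow> c n = d n) \<Longrightarrow> lincomb N c = lincomb N d"
  by (auto simp: lincomb_def)

lemma lincomb_comb: "lincomb N c + z *\<^sub>C lincomb N d = lincomb N (\<lambda>n. c n + z * d n)"
  by (simp add: lincomb_def complex_vector.scale_sum_right sum.distrib[symmetric]
      scaleC_scaleC scaleC_add_left)

lemma lincomb_diff: "lincomb N c - z *\<^sub>C lincomb N d = lincomb N (\<lambda>n. c n - z * d n)"
  using lincomb_comb[of N c "- z" d] by (simp add: complex_vector.scale_minus_left)

lemma lincomb_scale: "z *\<^sub>C lincomb N d = lincomb N (\<lambda>n. z * d n)"
  by (simp add: lincomb_def complex_vector.scale_sum_right scaleC_scaleC)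

lemma lincomb_extend:
  assumes "N \<le> M" "\<And>n. N < n \<Longrightarrow> n \<le> M \<Longrightarrow> c n = 0"
  shows "lincomb M c = lincomb N c"
  unfolding lincomb_def using assms by (intro sum.mono_neutral_right) auto

lemma lincomb_cutoff: "N \<le> M \<Longrightarrow> lincomb M (cutoff N c) = lincomb N c"
  using lincomb_extend[of N M "cutoff N c"] by (simp add: lincomb_def)

lemma cinner_lincomb_basis:
  "n \<ge> 1 \<Longrightarrow> cinner (lincomb N c) (e n) = (if n \<le> N then c n else 0)"
  by (auto simp: lincomb_def cinner_sum_left cinner_scaleC_left cinner_basis if_distrib
      cong: if_cong)

lemma cinner_lincomb: "cinner (lincomb N c) (lincomb N d) = (\<Sum>n=1..N. c n * cnj (d n))"
proof -
  have "cinner (lincomb N c) (lincomb N d) = (\<Sum>n=1..N. cnj (d n) * cinner (lincomb N c) (e n))"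
    by (simp add: lincomb_def[of N d] cinner_sum_right cinner_scaleC_right)
  also have "\<dots> = (\<Sum>n=1..N. c n * cnj (d n))"
    by (intro sum.cong) (auto simp: cinner_lincomb_basis)
  finally show ?thesis .
qed

lemma norm_lincomb: "(norm (lincomb N c))\<^sup>2 = (\<Sum>n=1..N. (cmod (c n))\<^sup>2)"
  by (simp add: norm_sq_cinner cinner_lincomb cmod_power2 complex_mult_cnj)

lemma cmod_le_norm_lincomb:
  assumes "1 \<le> n" "n \<le> N"
  shows "cmod (c n) \<le> norm (lincomb N c)"
proof (rule power2_le_imp_le)
  show "(cmod (c n))\<^sup>2 \<le> (norm (lincomb N c))\<^sup>2"
    unfolding norm_lincomb using assms by (intro member_le_sum) auto
qed simp

lemma lincomb_eq_0_iff: "lincomb N c = 0 \<longleftrightarrow> (\<forall>n\<in>{1..N}. c n = 0)"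
proof
  assume "lincomb N c = 0"
  then show "\<forall>n\<in>{1..N}. c n = 0"
    using cmod_le_norm_lincomb[of _ N c] by auto
qed (simp add: lincomb_def)

lemma subspace_lincomb: "complex_vector.subspace (range (lincomb N))"
proof (rule complex_vector.subspaceI)
  show "0 \<in> range (lincomb N)"
    by (rule image_eqI[of _ _ "\<lambda>_. 0"]) (auto simp: lincomb_def)
  show "x + y \<in> range (lincomb N)" if "x \<in> range (lincomb N)" "y \<in> range (lincomb N)" for x y
    using that lincomb_comb[of N _ 1] by auto
  show "c *\<^sub>C x \<in> range (lincomb N)" if "x \<in> range (lincomb N)" for c x
    using that lincomb_scale by auto
qed

lemma basis_in_range_lincomb: "1 \<le> n \<Longrightarrow> n \<le> N \<Longrightarrow> e n \<in> range (lincomb N)"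
proof (rule image_eqI[of _ _ "\<lambda>i. if i = n then 1 else 0"])
  assume "1 \<le> n" "n \<le> N"
  then have "lincomb N (\<lambda>i. if i = n then 1 else 0) = (\<Sum>i=1..N. if i = n then e n else 0)"
    unfolding lincomb_def by (intro sum.cong) auto
  then show "e n = lincomb N (\<lambda>i. if i = n then 1 else 0)"
    using \<open>1 \<le> n\<close> \<open>n \<le> N\<close> by simp
qed auto

lemma trunc_space_eq: "trunc_space e N = range (lincomb N)"
proof
  show "trunc_space e N \<subseteq> range (lincomb N)"
    unfolding trunc_space_def
    by (intro complex_vector.span_minimal subspace_lincomb) (auto intro: basis_in_range_lincomb)
  show "range (lincomb N) \<subseteq> trunc_space e N"
    unfolding trunc_space_def lincomb_def
    by (intro image_subsetI complex_vector.span_sum complex_vector.span_scale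
        complex_vector.span_base) auto
qed

lemma closure_lincomb: "closure (\<Union>N. range (lincomb N)) = UNIV"
proof -
  have sub: "complex_vector.subspace (\<Union>N. range (lincomb N))"
  proof (rule complex_vector.subspaceI)
    show "0 \<in> (\<Union>N. range (lincomb N))"
      using complex_vector.subspace_0[OF subspace_lincomb] by blast
    show "x + y \<in> (\<Union>N. range (lincomb N))"
      if xy: "x \<in> (\<Union>N. range (lincomb N))" "y \<in> (\<Union>N. range (lincomb N))" for x y
    proof -
      obtain N c M d where "x = lincomb N c" "y = lincomb M d" using xy by blast
      \<comment> \<open>Vectors of different lengths are padded with zeros to a common
        length.\<close>
      then have "x = lincomb (max N M) (cutoff N c)" "y = lincomb (max N M) (cutoff M d)"
        by (simp_all add: lincomb_cutoff)
      then have "x + y \<in> range (lincomb (max N M))"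
        by (simp add: complex_vector.subspace_add[OF subspace_lincomb])
      then show ?thesis by blast
    qed
    show "c *\<^sub>C x \<in> (\<Union>N. range (lincomb N))" if x: "x \<in> (\<Union>N. range (lincomb N))" for c x
    proof -
      obtain N where "x \<in> range (lincomb N)" using x by blast
      from complex_vector.subspace_scale[OF subspace_lincomb this] show ?thesis by blast
    qed
  qed
  have "e n \<in> (\<Union>N. range (lincomb N))" if "n \<ge> 1" for n
    by (rule UN_I[OF UNIV_I]) (rule basis_in_range_lincomb[OF that le_refl])
  then have "e ` {1..} \<subseteq> (\<Union>N. range (lincomb N))" by auto
  then have "cspan (e ` {1..}) \<subseteq> (\<Union>N. range (lincomb N))"
    by (rule complex_vector.span_minimal[OF _ sub])
  then have "closure (cspan (e ` {1..})) \<subseteq> closure (\<Union>N. range (lincomb N))"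
    by (rule closure_mono)
  then show ?thesis using basis by (auto simp: orthonormal_basis_def)
qed

text \<open>Compared with \<open>jacobi c\<close> on \<open>1..N\<close>, the sum has an extra entry
  at \<open>N + 1\<close>, coming from \<open>e N\<close>, and lacks the contribution of
  \<open>c (N + 1)\<close> to the entry at \<open>N\<close>. These are the two boundary
  terms.\<close>

lemma sum_tridiag_basis:
  assumes "N \<ge> 1" "c 0 = 0"
  shows "(\<Sum>n=1..N. c n *\<^sub>C tridiag_basis a b e n) =
    lincomb N (jacobi c) + (complex_of_real (a N) * c N) *\<^sub>C e (N + 1)
      - (complex_of_real (a N) * c (N + 1)) *\<^sub>C e N"
  using assms(1)
proof (induction N rule: nat_induct_at_least)
  case base
  show ?case
    using assms(2)
    by (simp add: lincomb_def jacobi_def tridiag_basis_def scaleR_scaleC scaleC_scaleC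
        scaleC_add_left scaleC_add_right mult.commute)
next
  case (Suc N)
  have "(\<Sum>n=1..Suc N. c n *\<^sub>C tridiag_basis a b e n)
     = (\<Sum>n=1..N. c n *\<^sub>C tridiag_basis a b e n) + c (Suc N) *\<^sub>C tridiag_basis a b e (Suc N)"
    by simp
  also have "\<dots> = lincomb (Suc N) (jacobi c)
      + (complex_of_real (a (Suc N)) * c (Suc N)) *\<^sub>C e (Suc N + 1)
      - (complex_of_real (a (Suc N)) * c (Suc N + 1)) *\<^sub>C e (Suc N)"
    unfolding Suc.IH using Suc.hyps
    by (simp add: lincomb_def jacobi_def tridiag_basis_def scaleR_scaleC scaleC_scaleC
        scaleC_add_left scaleC_add_right mult.commute)
  finally show ?case .
qed

section \<open>The operator on the linear span: explicit form, symmetry, linearity\<close>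

lemma tridiag_pre_eq:
  "tridiag_pre a b e = {(lincomb N c, lincomb (Suc N) (jacobi (cutoff N c))) | c N. True}"
proof -
  have "(\<Sum>n=1..N. c n *\<^sub>C tridiag_basis a b e n) = lincomb (Suc N) (jacobi (cutoff N c))" for c N
  proof (cases "N = 0")
    case True
    then show ?thesis by (simp add: lincomb_def jacobi_def cutoff_def)
  next
    case False
    have "(\<Sum>n=1..N. c n *\<^sub>C tridiag_basis a b e n) =
        (\<Sum>n=1..N. cutoff N c n *\<^sub>C tridiag_basis a b e n)"
      by (intro sum.cong) auto
    also have "\<dots> = lincomb (Suc N) (jacobi (cutoff N c))"
      using sum_tridiag_basis[of N "cutoff N c"] False
      by (simp add: lincomb_def jacobi_cutoff_last)
    finally show ?thesis .
  qed
  then show ?thesis unfolding tridiag_pre_def lincomb_def[of _ "_::nat\<Rightarrow>complex"] by simp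
qed

lemma lincomb_jacobi_cutoff:
  "N \<le> K \<Longrightarrow> lincomb (Suc K) (jacobi (cutoff N c)) = lincomb (Suc N) (jacobi (cutoff N c))"
  by (rule lincomb_extend) (auto intro!: jacobi_zero)

text \<open>The discrete Green identity. The diagonal cancels because \<open>b\<close> is real, the
  off-diagonal terms telescope, and the boundary form at \<open>0\<close> vanishes by
  hypothesis.\<close>

lemma jacobi_Green:
  assumes "c 0 = 0" "d 0 = 0"
  shows "(\<Sum>n=1..N. jacobi c n * cnj (d n)) - (\<Sum>n=1..N. c n * cnj (jacobi d n)) =
    complex_of_real (a N) * (c (N + 1) * cnj (d N) - c N * cnj (d (N + 1)))"
  using assms by (induction N) (simp_all add: jacobi_def algebra_simps)

lemma cinner_lincomb_jacobi:
  assumes "c 0 = 0" "d 0 = 0" "c (Suc N) = 0" "d (Suc N) = 0"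
  shows "cinner (lincomb N (jacobi c)) (lincomb N d) = cinner (lincomb N c) (lincomb N (jacobi d))"
  using jacobi_Green[of c d N] assms by (simp add: cinner_lincomb)

lemma tridiag_pre_symmetric: "tridiag_pre a b e \<subseteq> adjoint_op (tridiag_pre a b e)"
proof -
  have "cinner (lincomb (Suc M) (jacobi (cutoff M d))) (lincomb N c)
      = cinner (lincomb M d) (lincomb (Suc N) (jacobi (cutoff N c)))" for N c M d
  proof -
    \<comment> \<open>Length \<open>Suc ?K\<close> holds both images, and both sequences vanish at
      the index after it, so no boundary term survives.\<close>
    let ?K = "max N M"
    have "cinner (lincomb (Suc ?K) (jacobi (cutoff M d))) (lincomb (Suc ?K) (cutoff N c)) =
        cinner (lincomb (Suc ?K) (cutoff M d)) (lincomb (Suc ?K) (jacobi (cutoff N c)))"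
      by (rule cinner_lincomb_jacobi) auto
    then show ?thesis
      by (simp add: lincomb_cutoff lincomb_jacobi_cutoff[of N ?K] lincomb_jacobi_cutoff[of M ?K])
  qed
  then show ?thesis by (auto simp: tridiag_pre_eq adjoint_op_def)
qed

lemma tridiag_pre_linear: "op_linear (tridiag_pre a b e)"
proof -
  have "(lincomb N c + z *\<^sub>C lincomb M d,
      lincomb (Suc N) (jacobi (cutoff N c)) + z *\<^sub>C lincomb (Suc M) (jacobi (cutoff M d)))
      \<in> tridiag_pre a b e" for N c M d z
  proof -
    let ?K = "max N M" and ?f = "\<lambda>n. cutoff N c n + z * cutoff M d n"
    have "lincomb N c + z *\<^sub>C lincomb M d = lincomb ?K ?f"
      by (simp add: lincomb_comb[symmetric] lincomb_cutoff)
    moreover have "lincomb (Suc N) (jacobi (cutoff N c)) + z *\<^sub>C lincomb (Suc M) (jacobi (cutoff M d))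
        = lincomb (Suc ?K) (\<lambda>n. jacobi (cutoff N c) n + z * jacobi (cutoff M d) n)"
      by (simp add: lincomb_comb[symmetric] lincomb_jacobi_cutoff[of N ?K]
          lincomb_jacobi_cutoff[of M ?K])
    moreover have "cutoff ?K ?f = ?f" by (intro ext) (auto simp: cutoff_def)
    then have "(\<lambda>n. jacobi (cutoff N c) n + z * jacobi (cutoff M d) n) = jacobi (cutoff ?K ?f)"
      by (simp add: jacobi_comb)
    ultimately show ?thesis unfolding tridiag_pre_eq by auto
  qed
  then show ?thesis unfolding op_linear_def by (auto simp: tridiag_pre_eq[of])
qed

section \<open>The closed operator \<open>T\<close>\<close>

abbreviation T where "T \<equiv> tridiag_op a b e"

lemma T_symmetric: "T \<subseteq> adjoint_op T"
  unfolding tridiag_op_def by (rule closure_subset_adjoint_op[OF tridiag_pre_symmetric])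

lemma T_linear: "op_linear T"
  unfolding tridiag_op_def by (rule op_linear_closure[OF tridiag_pre_linear])

lemma lincomb_in_T: "(lincomb N c, lincomb (Suc N) (jacobi (cutoff N c))) \<in> T"
  unfolding tridiag_op_def tridiag_pre_eq by (rule closure_subset[THEN subsetD]) blast

lemma T_dense: "closure (Domain T) = UNIV"
proof -
  have "(\<Union>N. range (lincomb N)) \<subseteq> Domain T" using lincomb_in_T by blast
  from closure_mono[OF this] show ?thesis using closure_lincomb by auto
qed

text \<open>By symmetry the difference of two images is orthogonal to the dense domain.\<close>

lemma T_unique:
  assumes "(x, y) \<in> T" "(x, y') \<in> T"
  shows "y = y'"
proof -
  let ?d = "y - y'"
  have "(0, ?d) \<in> T" using op_linear_diff[OF T_linear assms] by simp
  then have "cinner v ?d = 0" if "v \<in> Domain T" for v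
    using that T_symmetric by (fastforce simp: adjoint_op_def)
  then have "Domain T \<subseteq> {v. cinner v ?d = 0}" by auto
  moreover have "closed {v. cinner v ?d = 0}"
    by (intro closed_Collect_eq continuous_intros)
  ultimately have "closure (Domain T) \<subseteq> {v. cinner v ?d = 0}" by (rule closure_minimal)
  then have "cinner ?d ?d = 0" unfolding T_dense by blast
  then show ?thesis by simp
qed

section \<open>Projections onto \<open>H_N\<close> and the truncated operators\<close>

lemma orth_proj_trunc_space:
  "orth_proj (trunc_space e N) x = lincomb N (\<lambda>n. cinner x (e n))"
  unfolding orth_proj_def
proof (rule the_equality)
  let ?y = "lincomb N (\<lambda>n. cinner x (e n))"
  have orth: "cinner (x - ?y) z = 0" if z: "z \<in> trunc_space e N" for z
  proof -
    obtain d where "z = lincomb N d" using z by (auto simp: trunc_space_eq)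
    then have "cinner (x - ?y) z = (\<Sum>n=1..N. cnj (d n) * cinner (x - ?y) (e n))"
      by (simp add: lincomb_def[of N d] cinner_sum_right cinner_scaleC_right)
    also have "\<dots> = 0"
      by (intro sum.neutral) (auto simp: cinner_diff_left cinner_lincomb_basis)
    finally show ?thesis .
  qed
  then show "?y \<in> trunc_space e N \<and> (\<forall>z\<in>trunc_space e N. cinner (x - ?y) z = 0)"
    by (auto simp: trunc_space_eq)
  fix y assume y: "y \<in> trunc_space e N \<and> (\<forall>z\<in>trunc_space e N. cinner (x - y) z = 0)"
  then have d: "y - ?y \<in> trunc_space e N"
    unfolding trunc_space_eq by (intro complex_vector.subspace_diff subspace_lincomb) auto
  have "cinner (y - ?y) (y - ?y) = cinner (x - ?y) (y - ?y) - cinner (x - y) (y - ?y)"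
    by (simp add: cinner_diff_left)
  also have "\<dots> = 0" using y orth d by simp
  finally show "y = ?y" by simp
qed

text \<open>\<open>T_unique\<close> identifies the image under the closure with the explicit
  three-term image, from which the projection removes just the entry at
  \<open>N + 1\<close>.\<close>

lemma trunc_op_eq: "trunc_op e T N = {(lincomb N c, lincomb N (jacobi (cutoff N c))) | c. True}"
proof -
  have P: "orth_proj (trunc_space e N) (lincomb M c) = lincomb N c" if "N \<le> M" for M c
    unfolding orth_proj_trunc_space using that
    by (intro lincomb_cong) (auto simp: cinner_lincomb_basis)
  have "(x, y) \<in> trunc_op e T N \<longleftrightarrow> (\<exists>c. x = lincomb N c \<and> y = lincomb N (jacobi (cutoff N c)))" for x y
  proof
    assume "(x, y) \<in> trunc_op e T N"
    then obtain y' c where y': "y = orth_proj (trunc_space e N) y'"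
      and c: "x = lincomb N c" and "(orth_proj (trunc_space e N) x, y') \<in> T"
      by (auto simp: trunc_op_def Let_def trunc_space_eq)
    then have "(lincomb N c, y') \<in> T" by (simp add: P)
    then have "y' = lincomb (Suc N) (jacobi (cutoff N c))"
      using lincomb_in_T T_unique by blast
    then show "\<exists>c. x = lincomb N c \<and> y = lincomb N (jacobi (cutoff N c))"
      using y' c P[of "Suc N"] by auto
  next
    assume "\<exists>c. x = lincomb N c \<and> y = lincomb N (jacobi (cutoff N c))"
    then obtain c where "x = lincomb N c" "y = lincomb N (jacobi (cutoff N c))" by blast
    then show "(x, y) \<in> trunc_op e T N"
      unfolding trunc_op_def Let_def
      using P[of N] P[of "Suc N"] lincomb_in_T[of N c]
      by (intro CollectI exI[of _ x] exI[of _ "lincomb (Suc N) (jacobi (cutoff N c))"])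
         (auto simp: trunc_space_eq)
  qed
  then show ?thesis by auto
qed

lemma trunc_op_symmetric: "trunc_op e T N \<subseteq> adjoint_op (trunc_op e T N)"
proof -
  have "cinner (lincomb N (jacobi (cutoff N d))) (lincomb N c)
      = cinner (lincomb N d) (lincomb N (jacobi (cutoff N c)))" for c d
    using cinner_lincomb_jacobi[of "cutoff N d" "cutoff N c" N] by (simp add: lincomb_cutoff)
  then show ?thesis by (auto simp: trunc_op_eq adjoint_op_def)
qed

lemma trunc_op_linear: "op_linear (trunc_op e T N)"
proof -
  have "\<exists>f. lincomb N c + z *\<^sub>C lincomb N d = lincomb N f \<and>
      lincomb N (jacobi (cutoff N c)) + z *\<^sub>C lincomb N (jacobi (cutoff N d)) = lincomb N (jacobi (cutoff N f))"
    for c d z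
    by (intro exI[of _ "\<lambda>n. c n + z * d n"])
       (simp add: lincomb_comb cutoff_comb jacobi_comb)
  then show ?thesis unfolding op_linear_def trunc_op_eq by blast
qed

subsection \<open>Eigenvalues of the truncations\<close>

lemma jacobi_cutoff:
  assumes "c 0 = 0" "c (Suc N) = 0" "1 \<le> n" "n \<le> N"
  shows "jacobi (cutoff N c) n = jacobi c n"
proof -
  have "cutoff N c (n + 1) = c (n + 1)" using assms by (cases "n = N") auto
  moreover have "cutoff N c (n - 1) = c (n - 1)" using assms by (cases "n = 1") auto
  ultimately show ?thesis using assms by (simp add: jacobi_def)
qed

text \<open>Forward recurrence for \<open>jacobi c - z c = f\<close> with \<open>c 0 = 0\<close> and
  \<open>c 1 = s\<close>. For \<open>f = 0\<close> and \<open>s = 1\<close> the value at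
  \<open>n \<ge> 1\<close> is the orthonormal polynomial of degree \<open>n - 1\<close> of the
  Jacobi matrix, evaluated at \<open>z\<close>.\<close>

fun rec_sol :: "complex \<Rightarrow> complex \<Rightarrow> (nat \<Rightarrow> complex) \<Rightarrow> nat \<Rightarrow> complex" where
  "rec_sol z s f 0 = 0"
| "rec_sol z s f (Suc 0) = s"
| "rec_sol z s f (Suc (Suc n)) =
     (f (Suc n) - (complex_of_real (b (Suc n)) - z) * rec_sol z s f (Suc n)
       - complex_of_real (a n) * rec_sol z s f n) / complex_of_real (a (Suc n))"

lemma jacobi_rec_sol:
  assumes "n \<ge> 1"
  shows "jacobi (rec_sol z s f) n - z * rec_sol z s f n = f n"
proof -
  obtain k where "n = Suc k" using assms by (cases n) auto
  moreover have "a (Suc k) \<noteq> 0" using a_pos[of "Suc k"] by simp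
  ultimately show ?thesis by (simp add: jacobi_def field_simps)
qed

text \<open>Shooting: a multiple of the homogeneous solution \<open>p\<close> is added to a
  particular solution \<open>q\<close> to make the entry at \<open>N + 1\<close> vanish. This is
  possible because \<open>p (Suc N) = 0\<close> would put \<open>p\<close>, with
  \<open>p 1 = 1\<close>, into the kernel.\<close>

lemma trunc_solve:
  assumes N: "N \<ge> 1"
    and inj: "\<And>c. \<forall>n\<in>{1..N}. jacobi (cutoff N c) n = z * c n \<Longrightarrow> \<forall>n\<in>{1..N}. c n = 0"
  shows "\<exists>c. \<forall>n\<in>{1..N}. jacobi (cutoff N c) n - z * c n = f n"
proof -
  define p where "p = rec_sol z 1 (\<lambda>_. 0)"
  define q where "q = rec_sol z 0 f"
  have p0: "p 0 = 0" "q 0 = 0" by (simp_all add: p_def q_def)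
  have pN: "p (Suc N) \<noteq> 0"
  proof
    assume "p (Suc N) = 0"
    then have "\<forall>n\<in>{1..N}. jacobi (cutoff N p) n = z * p n"
      using jacobi_cutoff[of p N] p0(1) jacobi_rec_sol[of _ z 1 "\<lambda>_. 0"] by (auto simp: p_def)
    from inj[OF this] have "p 1 = 0" using N by auto
    then show False by (simp add: p_def)
  qed
  define c where "c = (\<lambda>n. q n + (- q (Suc N) / p (Suc N)) * p n)"
  have "c 0 = 0" "c (Suc N) = 0" using pN p0 by (simp_all add: c_def)
  have "jacobi (cutoff N c) n - z * c n = f n" if "n \<in> {1..N}" for n
  proof -
    have "jacobi (cutoff N c) n = jacobi c n"
      using jacobi_cutoff \<open>c 0 = 0\<close> \<open>c (Suc N) = 0\<close> that by simp
    also have "\<dots> = jacobi q n + (- q (Suc N) / p (Suc N)) * jacobi p n"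
      unfolding c_def jacobi_comb ..
    also have "jacobi p n = z * p n" using jacobi_rec_sol[of n z 1 "\<lambda>_. 0"] that by (simp add: p_def)
    also have "jacobi q n = z * q n + f n"
      using jacobi_rec_sol[of n z 0 f] that by (simp add: q_def algebra_simps)
    finally show ?thesis by (simp add: c_def algebra_simps)
  qed
  then show ?thesis by blast
qed

section \<open>Minimal residuals and eigenvalues of the truncations\<close>

lemma lincomb_jacobi_scale:
  "lincomb N (jacobi (cutoff N (\<lambda>n. t * c n))) = t *\<^sub>C lincomb N (jacobi (cutoff N c))"
proof -
  have "jacobi (cutoff N (\<lambda>n. t * c n)) = (\<lambda>n. t * jacobi (cutoff N c) n)"
    by (auto simp: jacobi_def cutoff_def algebra_simps)
  then show ?thesis by (simp add: lincomb_scale)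
qed

lemma trunc_minimizer:
  assumes N: "N \<ge> 1"
  shows "\<exists>u. norm (lincomb N u) = 1 \<and>
    (\<forall>c. norm (lincomb N (jacobi (cutoff N u)) - z *\<^sub>C lincomb N u) * norm (lincomb N c)
        \<le> norm (lincomb N (jacobi (cutoff N c)) - z *\<^sub>C lincomb N c))"
proof -
  define F where "F c = norm (lincomb N (jacobi (cutoff N c)) - z *\<^sub>C lincomb N c)" for c
  have cutoff_cont: "continuous_on UNIV (\<lambda>c. cutoff N c n)" for n
    by (cases "1 \<le> n \<and> n \<le> N") (auto simp: cutoff_def)
  have lincomb_cont: "continuous_on UNIV (\<lambda>c. lincomb N (g c))"
    if "\<And>n. continuous_on UNIV (\<lambda>c. g c n)" for g :: "(nat \<Rightarrow> complex) \<Rightarrow> nat \<Rightarrow> complex"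
    unfolding lincomb_def by (intro continuous_intros that)
  have F_cont: "continuous_on UNIV F"
    unfolding F_def jacobi_def
    by (intro continuous_intros lincomb_cont cutoff_cont continuous_on_product_coordinates)
  \<comment> \<open>Coefficient sequences live in an infinite product, so compactness of the unit
    sphere comes from Tychonoff on a box that is zero outside \<open>1..N\<close>. Every unit vector
    enters it by \<open>cutoff\<close>, which leaves \<open>F\<close> unchanged.\<close>
  define B where "B = PiE UNIV (\<lambda>n. if 1 \<le> n \<and> n \<le> N then cball (0::complex) 1 else {0})"
  have "compact B"
  proof -
    have "compactin (product_topology (\<lambda>_. euclidean) UNIV) B"
      unfolding B_def by (subst compactin_PiE) auto
    then show ?thesis by (simp add: euclidean_product_topology)
  qed
  define S where "S = B \<inter> {c. norm (lincomb N c) = 1}"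
  have "closed {c. norm (lincomb N c) = 1}"
    by (intro closed_Collect_eq continuous_intros lincomb_cont continuous_on_product_coordinates)
  then have "compact S"
    unfolding S_def using \<open>compact B\<close> by (rule compact_Int_closed[rotated])
  have in_S: "cutoff N c \<in> S" if "norm (lincomb N c) = 1" for c
  proof -
    have "norm (lincomb N (cutoff N c)) = 1" using that by (simp add: lincomb_cutoff)
    moreover have "cutoff N c \<in> B"
      using cmod_le_norm_lincomb[of _ N c] that unfolding B_def by (auto simp: cutoff_def)
    ultimately show ?thesis unfolding S_def by simp
  qed
  have F_cutoff: "F (cutoff N c) = F c" for c
  proof -
    have "cutoff N (cutoff N c) = cutoff N c" by (auto simp: cutoff_def)
    then show ?thesis unfolding F_def by (simp add: lincomb_cutoff)
  qed
  obtain x where x: "x \<in> S" "\<And>y. y \<in> S \<Longrightarrow> F x \<le> F y"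
  proof -
    have *: "(norm (lincomb N (\<lambda>n. if n = 1 then 1 else 0)))\<^sup>2 = (\<Sum>n=1..N. if n = 1 then 1 else 0)"
      unfolding norm_lincomb by (intro sum.cong) auto
    have "norm (lincomb N (\<lambda>n. if n = 1 then 1 else 0)) = 1"
      by (rule power2_eq_imp_eq) (use N * in auto)
    then have "S \<noteq> {}" using in_S by blast
    then show ?thesis
      using continuous_attains_inf[OF \<open>compact S\<close> _ continuous_on_subset[OF F_cont subset_UNIV]] that
      by blast
  qed
  have "F x * norm (lincomb N c) \<le> F c" for c
  proof (cases "lincomb N c = 0")
    case True
    then show ?thesis by (simp add: F_def)
  next
    case False
    define t where "t = complex_of_real (1 / norm (lincomb N c))"
    have "norm (lincomb N (\<lambda>n. t * c n)) = 1"
      using False unfolding lincomb_scale[symmetric] norm_scaleC by (simp add: t_def norm_divide)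
    from x(2)[OF in_S[OF this]] have "F x \<le> F (\<lambda>n. t * c n)" by (simp add: F_cutoff)
    also have "F (\<lambda>n. t * c n) = norm (t *\<^sub>C (lincomb N (jacobi (cutoff N c)) - z *\<^sub>C lincomb N c))"
      unfolding F_def lincomb_jacobi_scale lincomb_scale[symmetric]
      by (simp add: complex_vector.scale_right_diff_distrib scaleC_scaleC mult.commute)
    also have "\<dots> = F c / norm (lincomb N c)"
      unfolding norm_scaleC by (simp add: t_def norm_divide F_def)
    finally show ?thesis using False by (simp add: field_simps)
  qed
  moreover have "norm (lincomb N x) = 1" using x(1) by (simp add: S_def)
  ultimately show ?thesis unfolding F_def by blast
qed

text \<open>Without an eigenvector the minimal residual is positive and \<open>trunc_solve\<close>
  gives solvability, so \<open>z\<close> would be a resolvent point.\<close>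

lemma trunc_spectrum_eigenvector:
  assumes N: "N \<ge> 1" and z: "z \<in> spectrum_on (trunc_space e N) (trunc_op e T N)"
  shows "\<exists>c. (\<forall>n\<in>{1..N}. jacobi (cutoff N c) n = z * c n) \<and> norm (lincomb N c) = 1"
proof (rule ccontr)
  assume no: "\<not> ?thesis"
  have inj: "\<forall>n\<in>{1..N}. c n = 0" if c: "\<forall>n\<in>{1..N}. jacobi (cutoff N c) n = z * c n" for c
  proof (rule ccontr)
    assume "\<not> ?thesis"
    then have nz: "norm (lincomb N c) \<noteq> 0" using lincomb_eq_0_iff by simp
    define t where "t = complex_of_real (1 / norm (lincomb N c))"
    have "norm (lincomb N (\<lambda>n. t * c n)) = 1"
      using nz unfolding lincomb_scale[symmetric] norm_scaleC by (simp add: t_def norm_divide)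
    moreover have "jacobi (cutoff N (\<lambda>n. t * c n)) n = t * jacobi (cutoff N c) n" for n
      by (auto simp: jacobi_def cutoff_def algebra_simps)
    ultimately show False using no c by (metis mult.left_commute)
  qed
  obtain u where u: "norm (lincomb N u) = 1"
    and min: "\<And>c. norm (lincomb N (jacobi (cutoff N u)) - z *\<^sub>C lincomb N u) * norm (lincomb N c)
      \<le> norm (lincomb N (jacobi (cutoff N c)) - z *\<^sub>C lincomb N c)"
    using trunc_minimizer[OF N] by blast
  have "z \<in> resolvent_set_on (trunc_space e N) (trunc_op e T N)"
  proof (rule resolvent_set_onI[OF trunc_op_linear])
    show "0 < norm (lincomb N (jacobi (cutoff N u)) - z *\<^sub>C lincomb N u)"
    proof (rule ccontr)
      assume "\<not> ?thesis"
      then have "\<forall>n\<in>{1..N}. jacobi (cutoff N u) n = z * u n"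
        by (simp add: lincomb_diff lincomb_eq_0_iff)
      with no u show False by blast
    qed
    show "norm (lincomb N (jacobi (cutoff N u)) - z *\<^sub>C lincomb N u) * norm x \<le> norm (y - z *\<^sub>C x)"
      if "(x, y) \<in> trunc_op e T N" for x y
      using that min by (auto simp: trunc_op_eq)
    show "\<exists>x. (x, u + z *\<^sub>C x) \<in> trunc_op e T N" if u: "u \<in> trunc_space e N" for u
    proof -
      obtain f where f: "u = lincomb N f" using u by (auto simp: trunc_space_eq)
      obtain c where "\<forall>n\<in>{1..N}. jacobi (cutoff N c) n - z * c n = f n"
        using trunc_solve[OF N inj] by blast
      then have "u + z *\<^sub>C lincomb N c = lincomb N (jacobi (cutoff N c))"
        unfolding f lincomb_comb by (intro lincomb_cong) (auto simp: algebra_simps)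
      then show ?thesis by (auto simp: trunc_op_eq)
    qed
  qed
  then show False using z by (simp add: spectrum_on_def)
qed

lemma trunc_spectrumI:
  assumes "lincomb N (jacobi (cutoff N c)) = z *\<^sub>C lincomb N c" "lincomb N c \<noteq> 0"
  shows "z \<in> spectrum_on (trunc_space e N) (trunc_op e T N)"
  using trunc_op_linear _ assms(2)
proof (rule eigenvector_in_spectrum_on)
  show "(lincomb N c, z *\<^sub>C lincomb N c) \<in> trunc_op e T N"
    unfolding trunc_op_eq using assms(1) by auto
  show "0 \<in> trunc_space e N"
    unfolding trunc_space_eq by (rule complex_vector.subspace_0[OF subspace_lincomb])
qed

lemma trunc_eigenvalue_near:
  fixes l :: real
  assumes N: "N \<ge> 1"
  shows "\<exists>z\<in>spectrum_on (trunc_space e N) (trunc_op e T N). \<forall>c.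
    dist z (complex_of_real l) * norm (lincomb N c)
      \<le> norm (lincomb N (jacobi (cutoff N c)) - complex_of_real l *\<^sub>C lincomb N c)"
proof -
  \<comment> \<open>Reading the coefficients off with inner products makes \<open>B\<close> a linear
    map on the whole space, as \<open>eigenvector_of_minimizer\<close> requires.\<close>
  define B where "B x = lincomb N (jacobi (cutoff N (\<lambda>n. cinner x (e n)))) - complex_of_real l *\<^sub>C x" for x
  have B: "B (lincomb N c) = lincomb N (jacobi (cutoff N c)) - complex_of_real l *\<^sub>C lincomb N c" for c
  proof -
    have "cutoff N (\<lambda>n. cinner (lincomb N c) (e n)) = cutoff N c"
      by (rule cutoff_cong) (simp add: cinner_lincomb_basis)
    then show ?thesis by (simp add: B_def)
  qed
  obtain u where u: "norm (lincomb N u) = 1"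
    and min: "\<And>c. norm (B (lincomb N u)) * norm (lincomb N c) \<le> norm (B (lincomb N c))"
    using trunc_minimizer[OF N] unfolding B by blast
  define r where "r = norm (B (lincomb N u))"
  have "\<exists>w\<in>range (lincomb N). w \<noteq> 0 \<and>
      (B w = complex_of_real r *\<^sub>C w \<or> B w = complex_of_real (- r) *\<^sub>C w)"
  proof (rule eigenvector_of_minimizer[where u = "lincomb N u"])
    show "complex_vector.subspace (range (lincomb N))" by (rule subspace_lincomb)
    show "B x \<in> range (lincomb N)" if "x \<in> range (lincomb N)" for x
      using that by (auto simp: B lincomb_diff)
    show "B (x + c *\<^sub>C y) = B x + c *\<^sub>C B y" for x y c
      unfolding B_def
      by (simp add: cinner_add_left cinner_scaleC_left cutoff_comb jacobi_comb lincomb_comb[symmetric]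
          complex_vector.scale_right_diff_distrib scaleC_add_right scaleC_scaleC mult.commute)
    show "cinner (B x) y = cinner x (B y)" if xy: "x \<in> range (lincomb N)" "y \<in> range (lincomb N)" for x y
    proof -
      obtain c d where cd: "x = lincomb N c" "y = lincomb N d" using xy by blast
      have "cinner (lincomb N (jacobi (cutoff N c))) (lincomb N d)
          = cinner (lincomb N c) (lincomb N (jacobi (cutoff N d)))"
        using cinner_lincomb_jacobi[of "cutoff N c" "cutoff N d" N] by (simp add: lincomb_cutoff)
      then show ?thesis
        unfolding cd B
        by (simp add: cinner_diff_left cinner_diff_right cinner_scaleC_left cinner_scaleC_right)
    qed
    show "lincomb N u \<noteq> 0" using u by auto
    show "norm (B (lincomb N u)) = r * norm (lincomb N u)" using u by (simp add: r_def)
    show "r * norm x \<le> norm (B x)" if "x \<in> range (lincomb N)" for x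
      using that min by (auto simp: r_def)
  qed (auto simp: r_def)
  then obtain c s where c: "lincomb N c \<noteq> 0" "B (lincomb N c) = complex_of_real s *\<^sub>C lincomb N c"
    and "s = r \<or> s = - r"
    by blast
  then have s: "\<bar>s\<bar> = r" by (auto simp: r_def)
  have "lincomb N (jacobi (cutoff N c)) = complex_of_real (l + s) *\<^sub>C lincomb N c"
    using c(2) unfolding B by (simp add: scaleC_add_left algebra_simps)
  \<comment> \<open>The eigenvalue \<open>l + s\<close> has distance \<open>r\<close> from
    \<open>l\<close>, and \<open>r\<close> is the least residual over unit vectors.\<close>
  from trunc_spectrumI[OF this c(1)]
  show ?thesis
    using min s unfolding r_def B
    by (intro bexI[of _ "complex_of_real (l + s)"]) (simp_all add: dist_norm)
qed

subsection \<open>The last coefficient of a truncated solution\<close>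

text \<open>Each induction step uses the recurrence once at \<open>n - j\<close> and moves to a
  neighbour. The lowest index at which it is used in \<open>m\<close> steps is
  \<open>n - j - m + 1\<close>, which explains the condition on \<open>n0\<close>.\<close>

lemma cmod_le_sum_paths:
  fixes c :: "nat \<Rightarrow> complex"
  assumes rec: "\<And>i. n0 \<le> i \<Longrightarrow> i \<le> n \<Longrightarrow> cmod (c i) * \<bar>b i\<bar> \<le>
      K * ((if i < n then a i * cmod (c (i + 1)) else 0) + a (i - 1) * cmod (c (i - 1)))"
    and b: "\<And>i. n0 \<le> i \<Longrightarrow> b i \<noteq> 0" and n0: "n0 \<ge> 2" and K: "K \<ge> 0"
    and M: "\<And>i. cmod (c i) \<le> M"
    and j: "j \<ge> 0" "int n0 + int m + j \<le> int n + 1"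
  shows "cmod (c (nat (int n - j))) \<le> K ^ m * M * sum (path_weight a b n m) (paths m j)"
  using j
proof (induction m arbitrary: j)
  case 0
  then show ?case using M by (simp add: path_weight_def)
next
  case (Suc m)
  define i where "i = nat (int n - j)"
  have i: "n0 \<le> i" "i \<le> n" using Suc.prems by (auto simp: i_def)
  have i1: "nat (int n - (j + 1)) = i - 1" using Suc.prems by (simp add: i_def)
  have a_i: "a i \<ge> 0" "a (i - 1) \<ge> 0" using a_pos[of i] a_pos[of "i - 1"] i n0 by (simp_all add: less_imp_le)
  let ?P = "\<lambda>j. sum (path_weight a b n m) (paths m j)"
  have down: "cmod (c (i - 1)) \<le> K ^ m * M * ?P (j + 1)"
    using Suc.IH[of "j + 1"] Suc.prems i1 by simp
  have up: "(if i < n then a i * cmod (c (i + 1)) else 0)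
      \<le> (if j \<ge> 1 then a i * (K ^ m * M * ?P (j - 1)) else 0)"
  proof (cases "j \<ge> 1")
    case True
    have "nat (int n - (j - 1)) = i + 1" using True Suc.prems by (simp add: i_def)
    then have "cmod (c (i + 1)) \<le> K ^ m * M * ?P (j - 1)"
      using Suc.IH[of "j - 1"] Suc.prems True by simp
    from mult_left_mono[OF this a_i(1)]
    show ?thesis using True Suc.prems by (simp add: i_def)
  next
    case False
    then have "j = 0" using Suc.prems by simp
    then show ?thesis by (simp add: i_def)
  qed
  have "cmod (c i) * \<bar>b i\<bar> \<le> K *
      ((if j \<ge> 1 then a i * (K ^ m * M * ?P (j - 1)) else 0) + a (i - 1) * (K ^ m * M * ?P (j + 1)))"
    by (rule order_trans[OF rec[OF i] mult_left_mono[OF add_mono[OF up mult_left_mono[OF down a_i(2)]] K]])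
  also have "\<dots> = K ^ Suc m * M *
      (a (i - 1) * ?P (j + 1) + (if j \<ge> 1 then a i * ?P (j - 1) else 0))"
    by (simp add: algebra_simps)
  also have "\<dots> = K ^ Suc m * M * sum (path_weight a b n (Suc m)) (paths (Suc m) j) * \<bar>b i\<bar>"
    unfolding sum_paths_Suc i_def[symmetric] i1 using b[OF i(1)] by simp
  finally show ?case
    using b[OF i(1)] unfolding i_def[symmetric] by simp
qed

lemma cmod_le_G_plus:
  fixes c :: "nat \<Rightarrow> complex"
  assumes rec: "\<And>i. n0 \<le> i \<Longrightarrow> i \<le> n \<Longrightarrow> cmod (c i) * \<bar>b i\<bar> \<le>
      K * ((if i < n then a i * cmod (c (i + 1)) else 0) + a (i - 1) * cmod (c (i - 1)))"
    and b: "\<And>i. n0 \<le> i \<Longrightarrow> b i \<noteq> 0" and n0: "n0 \<ge> 2" and K: "K \<ge> 0"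
    and M: "\<And>i. cmod (c i) \<le> M"
    and m: "m \<ge> 1" and n: "n0 + m \<le> n"
  shows "cmod (c n) \<le> K ^ m * M * G_plus a b m n"
proof -
  have "cmod (c n) \<le> K ^ m * M * sum (path_weight a b n m) (paths m 0)"
    using cmod_le_sum_paths[OF rec b n0 K M, of 0 m] n by simp
  also have "sum (path_weight a b n m) (paths m 0) \<le> sum (path_weight a b n m) (multi_indices m)"
  proof (rule sum_mono2[OF finite_multi_indices paths_subset_multi_indices[OF m]])
    fix p assume "p \<in> multi_indices m - paths m 0"
    then obtain js ks where p: "p = (js, ks)" "(js, ks) \<in> multi_indices m" by (cases p) auto
    have "0 \<le> a (nat (int n - ks ! s)) / \<bar>b (nat (int n - js ! s))\<bar>" if "s < m" for s
    proof -
      \<comment> \<open>Since \<open>ks ! s \<le> m\<close> and \<open>n0 + m \<le> n\<close>, the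
        index stays in the range where \<open>a\<close> is positive.\<close>
      have "nat (int n - ks ! s) \<ge> 1" using multi_indices_bounds(2)[OF p(2) that] that n n0 by simp
      from a_pos[OF this] show ?thesis by simp
    qed
    then show "0 \<le> path_weight a b n m p"
      unfolding p path_weight_def by (auto intro: prod_nonneg)
  qed
  also have "sum (path_weight a b n m) (multi_indices m) = G_plus a b m n"
    by (simp add: G_plus_def path_weight_def)
  finally show ?thesis
    using K order_trans[OF norm_ge_zero M] by (simp add: mult_left_mono)
qed

text \<open>\<open>N0\<close> is uniform in \<open>c\<close>, \<open>M\<close> and all
  \<open>z\<close> in the disc of radius \<open>R\<close>, so \<open>z\<close> may vary with
  \<open>N\<close>. The eigenvalue equation is required only from \<open>n1\<close> on, which admits
  right-hand sides supported below \<open>n1\<close>.\<close>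

lemma last_coefficient_small:
  assumes m: "m \<ge> 1" and b: "filterlim (\<lambda>n. \<bar>b n\<bar>) at_top sequentially"
    and G: "(\<lambda>n. a n * G_plus a b m n) \<longlonglongrightarrow> 0" and eps: "\<epsilon> > 0"
  shows "\<exists>N0. \<forall>N\<ge>N0. \<forall>c z M. cmod z \<le> R \<longrightarrow>
    (\<forall>n\<in>{n1..N}. jacobi (cutoff N c) n = z * c n) \<longrightarrow>
    (\<forall>n\<in>{1..N}. cmod (c n) \<le> M) \<longrightarrow> a N * cmod (c N) \<le> \<epsilon> * M"
proof -
  \<comment> \<open>The term \<open>2 * \<bar>R\<bar>\<close> gives
    \<open>\<bar>b i - z\<bar> \<ge> \<bar>b i\<bar> / 2\<close>, hence the constant
    \<open>K = 2\<close>; the \<open>1\<close> keeps \<open>b i\<close> nonzero.\<close>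
  have "eventually (\<lambda>n. 2 * \<bar>R\<bar> + 1 \<le> \<bar>b n\<bar>) sequentially"
    using b by (simp add: filterlim_at_top)
  then obtain n2 where n2: "\<And>i. i \<ge> n2 \<Longrightarrow> \<bar>b i\<bar> \<ge> 2 * \<bar>R\<bar> + 1"
    unfolding eventually_sequentially by blast
  define n0 where "n0 = max 2 (max n1 n2)"
  have "eventually (\<lambda>n. a n * G_plus a b m n < \<epsilon> / 2 ^ m) sequentially"
    using G eps by (intro order_tendstoD) auto
  then obtain N1 where N1: "\<And>n. n \<ge> N1 \<Longrightarrow> a n * G_plus a b m n < \<epsilon> / 2 ^ m"
    unfolding eventually_sequentially by blast
  show ?thesis
  proof (intro exI[of _ "max N1 (n0 + m)"] allI impI)
    fix N c z M
    assume N: "max N1 (n0 + m) \<le> N" and z: "cmod z \<le> R"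
      and eq: "\<forall>n\<in>{n1..N}. jacobi (cutoff N c) n = z * c n"
      and M: "\<forall>n\<in>{1..N}. cmod (c n) \<le> M"
    have N': "n0 + m \<le> N" "N \<ge> 1" "n0 \<ge> 2" using N by (auto simp: n0_def)
    have M0: "M \<ge> 0" using M N'(2) norm_ge_zero[of "c N"] by (meson atLeastAtMost_iff order_refl order_trans)
    define d where "d = cutoff N c"
    have "cmod (d N) \<le> 2 ^ m * M * G_plus a b m N"
    proof (rule cmod_le_G_plus[OF _ _ N'(3) _ _ m N'(1)])
      show "cmod (d i) * \<bar>b i\<bar> \<le>
          2 * ((if i < N then a i * cmod (d (i + 1)) else 0) + a (i - 1) * cmod (d (i - 1)))"
        if i: "n0 \<le> i" "i \<le> N" for i
      proof -
        have pos: "a i > 0" "a (i - 1) > 0" using i by (auto simp: n0_def intro!: a_pos)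
        have "jacobi d i = z * d i" using eq i by (simp add: d_def n0_def)
        then have "(complex_of_real (b i) - z) * d i =
            - (complex_of_real (a i) * d (i + 1) + complex_of_real (a (i - 1)) * d (i - 1))"
          by (simp add: jacobi_def algebra_simps)
        then have "cmod (complex_of_real (b i) - z) * cmod (d i) =
            cmod (complex_of_real (a i) * d (i + 1) + complex_of_real (a (i - 1)) * d (i - 1))"
          by (metis norm_minus_cancel norm_mult)
        also have "\<dots> \<le> a i * cmod (d (i + 1)) + a (i - 1) * cmod (d (i - 1))"
          using pos by (intro order_trans[OF norm_triangle_ineq]) (simp add: norm_mult)
        \<comment> \<open>At \<open>i = N\<close> the cut-off entry beyond \<open>N\<close> is zero;
          this is why only paths staying in \<open>{..N}\<close> occur.\<close>
        also have "a i * cmod (d (i + 1)) = (if i < N then a i * cmod (d (i + 1)) else 0)"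
          using i by (auto simp: d_def)
        finally have 1: "cmod (complex_of_real (b i) - z) * cmod (d i) \<le>
          (if i < N then a i * cmod (d (i + 1)) else 0) + a (i - 1) * cmod (d (i - 1))" .
        have "2 * \<bar>R\<bar> + 1 \<le> \<bar>b i\<bar>" using n2 i by (simp add: n0_def)
        then have "\<bar>b i\<bar> \<le> 2 * cmod (complex_of_real (b i) - z)"
          using norm_triangle_ineq2[of "complex_of_real (b i)" z] z by simp
        from mult_left_mono[OF this, of "cmod (d i)"] 1 show ?thesis by (simp add: mult.commute)
      qed
      show "b i \<noteq> 0" if "n0 \<le> i" for i
        using n2[of i] that by (auto simp: n0_def)
      show "cmod (d i) \<le> M" for i
        using M M0 by (simp add: d_def cutoff_def)
    qed simp
    then have "a N * cmod (c N) \<le> a N * (2 ^ m * M * G_plus a b m N)"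
      using N' a_pos[of N] by (simp add: d_def)
    also have "\<dots> = (2 ^ m * M) * (a N * G_plus a b m N)" by simp
    also have "\<dots> \<le> (2 ^ m * M) * (\<epsilon> / 2 ^ m)"
      using N1[of N] N M0 by (intro mult_left_mono) auto
    finally show "a N * cmod (c N) \<le> \<epsilon> * M" by (simp add: mult.commute)
  qed
qed

end

section \<open>The spectrum as a limit of eigenvalues\<close>

locale tridiagonal_vanishing = tridiagonal e a b
  for e :: "nat \<Rightarrow> 'a::chilbert_space" and a b :: "nat \<Rightarrow> real" +
  fixes m :: nat
  assumes m: "m \<ge> 1"
    and b_infinity: "filterlim (\<lambda>n. \<bar>b n\<bar>) at_top sequentially"
    and G_vanishing: "(\<lambda>n. a n * G_plus a b m n) \<longlonglongrightarrow> 0"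
begin

section \<open>Range of \<open>T - z\<close> for nonreal \<open>z\<close> and
  self-adjointness\<close>

lemma norm_lincomb_jacobi_defect:
  assumes "N \<ge> 1"
  shows "norm (lincomb (Suc N) (jacobi (cutoff N c)) - lincomb N (jacobi (cutoff N c)))
    = a N * cmod (c N)"
proof -
  have "norm (e (Suc N)) = 1"
    using norm_sq_cinner[of "e (Suc N)"] cinner_basis[of "Suc N" "Suc N"]
    by (simp add: power2_eq_1_iff) (use norm_ge_zero[of "e (Suc N)"] in linarith)
  moreover have "lincomb (Suc N) (jacobi (cutoff N c)) - lincomb N (jacobi (cutoff N c))
      = (complex_of_real (a N) * c N) *\<^sub>C e (Suc N)"
    using assms by (simp add: lincomb_def jacobi_cutoff_last)
  ultimately show ?thesis
    using a_pos[OF assms] by (simp add: norm_scaleC norm_mult)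
qed

lemma T_onto:
  assumes z: "Im z \<noteq> 0"
  shows "\<exists>x. (x, u + z *\<^sub>C x) \<in> T"
proof -
  define Rg where "Rg = {u. \<exists>x. (x, u + z *\<^sub>C x) \<in> T}"
  have "closed Rg"
    unfolding Rg_def
  proof (rule closed_range_of_lower_bound[OF T_linear])
    show "closed T" by (simp add: tridiag_op_def)
    show "\<bar>Im z\<bar> > 0" using z by simp
    show "\<bar>Im z\<bar> * norm x \<le> norm (y - z *\<^sub>C x)" if "(x, y) \<in> T" for x y
      using symmetric_lower_bound[OF T_symmetric that] .
  qed
  have "lincomb K f \<in> Rg" for K f
  proof -
    \<comment> \<open>By symmetry of the truncations \<open>M\<close> bounds the solutions of
      \<open>(T_N - z) c = f\<close> for every \<open>N\<close> at once.\<close>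
    define M where "M = norm (lincomb K f) / \<bar>Im z\<bar>"
    have M: "M \<ge> 0" by (simp add: M_def)
    have "\<exists>u\<in>Rg. dist u (lincomb K f) < \<epsilon>" if \<epsilon>: "\<epsilon> > 0" for \<epsilon>
    proof -
      \<comment> \<open>With \<open>M + 1\<close> the final bound
        \<open>\<epsilon> M / (M + 1)\<close> is strictly below \<open>\<epsilon>\<close>, also for
        \<open>M = 0\<close>. The recurrence is homogeneous from \<open>Suc K\<close> on, past the
        support of the right-hand side.\<close>
      have "\<epsilon> / (M + 1) > 0" using M \<epsilon> by simp
      from last_coefficient_small[OF m b_infinity G_vanishing this, of "cmod z" "Suc K"]
      obtain N0 where N0: "\<And>N c M'. N \<ge> N0 \<Longrightarrow>
          \<forall>n\<in>{Suc K..N}. jacobi (cutoff N c) n = z * c n \<Longrightarrow>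
          \<forall>n\<in>{1..N}. cmod (c n) \<le> M' \<Longrightarrow> a N * cmod (c N) \<le> \<epsilon> / (M + 1) * M'"
        by blast
      define N where "N = max N0 (Suc K)"
      have N: "N \<ge> 1" "N \<ge> N0" "N \<ge> K" by (auto simp: N_def)
      have lower: "\<bar>Im z\<bar> * norm (lincomb N c)
          \<le> norm (lincomb N (\<lambda>n. jacobi (cutoff N c) n - z * c n))" for c
        using symmetric_lower_bound[OF trunc_op_symmetric, of "lincomb N c" "lincomb N (jacobi (cutoff N c))" N z]
        by (auto simp: trunc_op_eq lincomb_diff)
      have "\<forall>n\<in>{1..N}. c n = 0" if c: "\<forall>n\<in>{1..N}. jacobi (cutoff N c) n = z * c n" for c
      proof -
        have "lincomb N (\<lambda>n. jacobi (cutoff N c) n - z * c n) = 0"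
          using c by (simp add: lincomb_eq_0_iff)
        then have "lincomb N c = 0" using lower[of c] z by (simp add: mult_le_0_iff)
        then show ?thesis by (simp only: lincomb_eq_0_iff)
      qed
      from trunc_solve[OF N(1) this]
      obtain c where c: "\<forall>n\<in>{1..N}. jacobi (cutoff N c) n - z * c n = cutoff K f n" by blast
      have "lincomb N (\<lambda>n. jacobi (cutoff N c) n - z * c n) = lincomb N (cutoff K f)"
        by (rule lincomb_cong) (use c in simp)
      also have "\<dots> = lincomb K f" by (rule lincomb_cutoff[OF N(3)])
      finally have sol: "lincomb N (\<lambda>n. jacobi (cutoff N c) n - z * c n) = lincomb K f" .
      have "norm (lincomb N c) \<le> M"
        using lower[of c] z unfolding sol M_def by (simp add: field_simps)
      then have "\<forall>n\<in>{1..N}. cmod (c n) \<le> M"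
        using cmod_le_norm_lincomb[of _ N c] by force
      moreover have "jacobi (cutoff N c) n = z * c n" if "n \<in> {Suc K..N}" for n
        using bspec[OF c, of n] that by simp
      ultimately have "a N * cmod (c N) \<le> \<epsilon> / (M + 1) * M"
        using N0[OF N(2)] by blast
      also have "\<dots> < \<epsilon>" using M \<epsilon> by (simp add: field_simps)
      finally have small: "a N * cmod (c N) < \<epsilon>" .
      define u where "u = lincomb (Suc N) (jacobi (cutoff N c)) - z *\<^sub>C lincomb N c"
      have "u \<in> Rg"
        unfolding Rg_def u_def using lincomb_in_T[of N c]
        by (intro CollectI exI[of _ "lincomb N c"]) simp
      moreover have "u - lincomb K f = lincomb (Suc N) (jacobi (cutoff N c)) - lincomb N (jacobi (cutoff N c))"
        unfolding u_def sol[symmetric] lincomb_diff[symmetric] by simp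
      then have "dist u (lincomb K f) < \<epsilon>"
        using small norm_lincomb_jacobi_defect[OF N(1)] by (simp add: dist_norm)
      ultimately show ?thesis by blast
    qed
    then show ?thesis using closed_approachable[OF \<open>closed Rg\<close>] by blast
  qed
  then have "(\<Union>N. range (lincomb N)) \<subseteq> Rg" by blast
  from closure_minimal[OF this \<open>closed Rg\<close>] have "u \<in> Rg" using closure_lincomb by blast
  then show ?thesis by (simp add: Rg_def)
qed

lemma self_adjoint_T: "self_adjoint T"
  by (rule self_adjointI[OF T_symmetric T_linear T_dense]) (rule T_onto, simp)+

section \<open>The inclusion \<Lambda>(T) \<subseteq> \<sigma>(T)\<close>

lemma limit_eigenvalues_subset: "limit_eigenvalues e T \<subseteq> spectrum T"
proof
  fix z assume "z \<in> limit_eigenvalues e T"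
  then obtain l r where l: "\<forall>N\<ge>1. l N \<in> spectrum_on (trunc_space e N) (trunc_op e T N)"
    and r: "strict_mono r" and lim: "(l \<circ> r) \<longlonglongrightarrow> z"
    by (auto simp: limit_eigenvalues_def)
  show "z \<in> spectrum T"
  proof (rule ccontr)
    assume "z \<notin> spectrum T"
    then obtain C where "\<forall>(x, y)\<in>T. norm x \<le> C * norm (y - z *\<^sub>C x)"
      unfolding spectrum_on_def resolvent_set_on_def by blast
    then have C: "norm x \<le> C * norm (y - z *\<^sub>C x)" if "(x, y) \<in> T" for x y
      using that by blast
    \<comment> \<open>Defect and eigenvalue error contribute at most \<open>d\<close> each, and
      \<open>\<bar>C\<bar> * (2 * d) < 1\<close> contradicts the resolvent bound at a unit
      vector.\<close>
    define d where "d = 1 / (4 * (\<bar>C\<bar> + 1))"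
    have d: "d > 0" by (simp add: d_def)
    obtain N0 where N0: "\<And>N c z' M. N \<ge> N0 \<Longrightarrow> cmod z' \<le> cmod z + d \<Longrightarrow>
        \<forall>n\<in>{1..N}. jacobi (cutoff N c) n = z' * c n \<Longrightarrow>
        \<forall>n\<in>{1..N}. cmod (c n) \<le> M \<Longrightarrow> a N * cmod (c N) \<le> d * M"
      using last_coefficient_small[OF m b_infinity G_vanishing d, of "cmod z + d" 1] by blast
    obtain k0 where k0: "\<And>k. k \<ge> k0 \<Longrightarrow> dist (l (r k)) z < d"
      using metric_LIMSEQ_D[OF lim d] by auto
    define N where "N = r (max k0 (max N0 1))"
    have "max k0 (max N0 1) \<le> N" unfolding N_def by (rule seq_suble[OF r])
    then have N: "N \<ge> 1" "N \<ge> N0" by auto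
    have lz: "cmod (l N - z) < d" using k0 unfolding N_def dist_norm by simp
    then have "cmod (l N) \<le> cmod z + d" using norm_triangle_sub[of "l N" z] by simp
    moreover obtain c where c: "\<forall>n\<in>{1..N}. jacobi (cutoff N c) n = l N * c n"
      and c1: "norm (lincomb N c) = 1"
      using trunc_spectrum_eigenvector N(1) l by blast
    moreover have "\<forall>n\<in>{1..N}. cmod (c n) \<le> 1"
      using cmod_le_norm_lincomb[of _ N c] c1 by auto
    ultimately have small: "a N * cmod (c N) \<le> d * 1" using N0[OF N(2)] by blast
    let ?y = "lincomb (Suc N) (jacobi (cutoff N c))"
    have "lincomb N (jacobi (cutoff N c)) = l N *\<^sub>C lincomb N c"
      unfolding lincomb_scale using c by (intro lincomb_cong) auto
    then have split: "?y - z *\<^sub>C lincomb N c = (?y - lincomb N (jacobi (cutoff N c))) + (l N - z) *\<^sub>C lincomb N c"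
      by (simp add: complex_vector.scale_left_diff_distrib)
    have "norm (?y - z *\<^sub>C lincomb N c) \<le> a N * cmod (c N) + cmod (l N - z)"
      unfolding split using norm_triangle_ineq[of "?y - lincomb N (jacobi (cutoff N c))" "(l N - z) *\<^sub>C lincomb N c"]
      by (simp add: norm_lincomb_jacobi_defect[OF N(1)] norm_scaleC c1)
    also have "\<dots> \<le> 2 * d" using small lz by simp
    finally have "\<bar>C\<bar> * norm (?y - z *\<^sub>C lincomb N c) \<le> \<bar>C\<bar> * (2 * d)"
      by (rule mult_left_mono) simp
    moreover have "1 \<le> C * norm (?y - z *\<^sub>C lincomb N c)"
      using C[OF lincomb_in_T, of N c] c1 by simp
    moreover have "C * norm (?y - z *\<^sub>C lincomb N c) \<le> \<bar>C\<bar> * norm (?y - z *\<^sub>C lincomb N c)"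
      by (rule mult_right_mono) auto
    moreover have "\<bar>C\<bar> * (2 * d) < 1" by (simp add: d_def field_simps)
    ultimately show False by linarith
  qed
qed

section \<open>The inclusion \<sigma>(T) \<subseteq> \<Lambda>(T)\<close>

lemma spectrum_subset: "spectrum T \<subseteq> limit_eigenvalues e T"
proof
  fix z assume z: "z \<in> spectrum T"
  have "Im z = 0"
  proof (rule ccontr)
    assume "Im z \<noteq> 0"
    then have "z \<in> resolvent_set_on UNIV T"
      using symmetric_lower_bound[OF T_symmetric] T_onto
      by (intro resolvent_set_onI[OF T_linear, of "\<bar>Im z\<bar>"]) auto
    then show False using z by (simp add: spectrum_on_def)
  qed
  then have "z = complex_of_real (Re z)" by (simp add: complex_eq_iff)
  then obtain l where zl: "z = complex_of_real l" by blast
  obtain f where f: "\<And>N. N \<ge> 1 \<Longrightarrow> f N \<in> spectrum_on (trunc_space e N) (trunc_op e T N)"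
    and near: "\<And>N c. N \<ge> 1 \<Longrightarrow> dist (f N) z * norm (lincomb N c)
      \<le> norm (lincomb N (jacobi (cutoff N c)) - z *\<^sub>C lincomb N c)"
    using trunc_eigenvalue_near[of _ l] unfolding zl by metis
  have "f \<longlonglongrightarrow> z"
  proof (rule metric_LIMSEQ_I)
    fix \<epsilon> :: real assume \<epsilon>: "\<epsilon> > 0"
    \<comment> \<open>Otherwise \<open>\<epsilon>\<close> is a lower bound for \<open>T - l\<close>,
      and \<open>real_resolventI\<close> makes \<open>l\<close> a resolvent point.\<close>
    have "\<exists>(x, y)\<in>T. norm (y - z *\<^sub>C x) < \<epsilon> * norm x"
    proof (rule ccontr)
      assume "\<not> ?thesis"
      then have bound: "\<epsilon> * norm x \<le> norm (y - complex_of_real l *\<^sub>C x)" if "(x, y) \<in> T" for x y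
        using that zl by fastforce
      have "z \<in> resolvent_set_on UNIV T"
        unfolding zl
        by (rule real_resolventI[OF T_symmetric T_linear \<epsilon> bound]) (simp_all add: T_onto)
      then show False using z by (simp add: spectrum_on_def)
    qed
    then obtain x y where xy: "(x, y) \<in> T" "\<epsilon> * norm x - norm (y - z *\<^sub>C x) > 0" by auto
    then obtain s where s: "\<And>k. s k \<in> tridiag_pre a b e" "s \<longlonglongrightarrow> (x, y)"
      unfolding tridiag_op_def closure_sequential by blast
    \<comment> \<open>The strict inequality is an open condition on the graph, so it passes to an
      approximating vector of finite support.\<close>
    have "(\<lambda>k. \<epsilon> * norm (fst (s k)) - norm (snd (s k) - z *\<^sub>C fst (s k)))
        \<longlonglongrightarrow> \<epsilon> * norm x - norm (y - z *\<^sub>C x)"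
      using tendsto_fst[OF s(2)] tendsto_snd[OF s(2)] by (auto intro!: tendsto_intros)
    from order_tendstoD(1)[OF this xy(2)]
    obtain k where "\<epsilon> * norm (fst (s k)) - norm (snd (s k) - z *\<^sub>C fst (s k)) > 0"
      by (meson eventually_sequentially order_refl)
    then obtain c K where c: "norm (lincomb (Suc K) (jacobi (cutoff K c)) - z *\<^sub>C lincomb K c)
        < \<epsilon> * norm (lincomb K c)"
      using s(1)[of k] by (auto simp: tridiag_pre_eq)
    \<comment> \<open>The image of \<open>lincomb K c\<close> reaches up to index
      \<open>K + 1\<close>, so from \<open>N = Suc K\<close> on \<open>T\<close> and
      \<open>T_N\<close> agree on this vector.\<close>
    have "dist (f N) z < \<epsilon>" if N: "N \<ge> Suc K" for N
    proof -
      obtain N' where N': "N = Suc N'" "K \<le> N'" using N by (cases N) auto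
      have "cutoff N (cutoff K c) = cutoff K c" using N by (auto simp: cutoff_def)
      then have "dist (f N) z * norm (lincomb K c) < \<epsilon> * norm (lincomb K c)"
        using near[of N "cutoff K c"] c N N'(2)
        by (simp add: lincomb_cutoff N'(1) lincomb_jacobi_cutoff[OF N'(2)])
      then show ?thesis by (simp add: mult_less_cancel_right)
    qed
    then show "\<exists>n0. \<forall>n\<ge>n0. dist (f n) z < \<epsilon>" by blast
  qed
  then show "z \<in> limit_eigenvalues e T"
    unfolding limit_eigenvalues_def using f
    by (intro CollectI exI[of _ f] exI[of _ id]) (auto simp: strict_mono_id)
qed

end

theorem theorem3p3:
  fixes e :: "nat \<Rightarrow> 'a::chilbert_space"
    and a b :: "nat \<Rightarrow> real"
    and m :: nat
  assumes "orthonormal_basis e"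
    and "\<And>n. n \<ge> 1 \<Longrightarrow> a n > 0"
    and "m \<ge> 1"
    and "filterlim (\<lambda>n. \<bar>b n\<bar>) at_top sequentially"
    and "(\<lambda>n. a n * G_plus a b m n) \<longlonglongrightarrow> 0"
  shows "self_adjoint (tridiag_op a b e) \<and>
         limit_eigenvalues e (tridiag_op a b e) = spectrum (tridiag_op a b e)"
proof -
  interpret tridiagonal_vanishing e a b m
    by unfold_locales (fact assms)+
  show ?thesis
    using self_adjoint_T limit_eigenvalues_subset spectrum_subset by blast
qed

end
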